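(* Let $n,d,r$ be positive integers. There exists an open and dense semi-algebraic set $\mathcal{U}_4$ in $\mathbb{R}^{r\times n(d)}$ such that the following holds for any $u\in\mathcal{U}_4$: for any distinct points $x^0,\tilde{x}^0\in\mathrm{Crit}(\mathcal{C}(F(x,u)))$ and any (not necessarily distinct) $f,\tilde{f}\in\mathcal{C}(F(x,u))$ such that $x^0$ is a critical point of $f$ and $\tilde{x}^0$ is a critical point of $\tilde{f}$, one has $f(x^0)\neq\tilde{f}(\tilde{x}^0)$.
   Context: Let $n(d):=\#\{\alpha\in\mathbb{N}^n : |\alpha|\le d\}$, where $|\alpha|=\alpha_1+\cdots+\alpha_n$. For $u=(u^{(1)},\ldots,u^{(r)})\in\mathbb{R}^{r\times n(d)}$ with $u^{(i)}=(u^{(i)}_\alpha)_{|\alpha|\le d}\in\mathbb{R}^{n(d)}$, put $f_i(x,u^{(i)})=\sum_{|\alpha|\le d}u^{(i)}_\alpha x^\alpha$, a polynomial in $x\in\mathbb{R}^n$ of degree at most $d$, and $F(x,u)=(f_1(x,u^{(1)}),\ldots,f_r(x,u^{(r)}))$. $\mathcal{C}(F(x,u))$ is the set of all continuous selections of these polynomials, i.e. all continuous functions $f\colon\mathbb{R}^n\to\mathbb{R}$ with $f(x)\in\{f_1(x,u^{(1)}),\ldots,f_r(x,u^{(r)})\}$ for every $x\in\mathbb{R}^n$; such functions are locally Lipschitz. For a locally Lipschitz $f$, $f^0(\bar x;v)=\limsup_{x\to\bar x,\,t\downarrow0}\frac{f(x+tv)-f(x)}{t}$ and the Clarke subdifferential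 is $\partial^\circ f(\bar x)=\{\zeta\in\mathbb{R}^n : \langle\zeta,v\rangle\le f^0(\bar x;v)\ \forall v\in\mathbb{R}^n\}$. A point $x^0$ is a critical point of $f$ if $0\in\partial^\circ f(x^0)$. $\mathrm{Crit}(\mathcal{C}(F(x,u)))$ is the set of all points that are critical for at least one $f\in\mathcal{C}(F(x,u))$. *)

theory Defs
  imports "HOL-Analysis.Analysis"
begin

(* The degree bound d enters as the type parameter 'd, with d = CARD('d); since types are
   nonempty, exactly the positive integers d arise (and likewise n = CARD('n), r = CARD('r)). *)
typedef ('n, 'd) multi_index =
  "{\<alpha> :: 'n::finite \<Rightarrow> nat. (\<Sum>j\<in>UNIV. \<alpha> j) \<le> CARD('d::finite)}"
  morphisms exponent Multi_Index
  by (rule exI[of _ "\<lambda>_. 0"]) simp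

lemma finite_multi_indices: "finite {\<alpha> :: 'n::finite \<Rightarrow> nat. (\<Sum>j\<in>UNIV. \<alpha> j) \<le> d}"
proof (rule finite_subset)
  show "{\<alpha> :: 'n \<Rightarrow> nat. (\<Sum>j\<in>UNIV. \<alpha> j) \<le> d} \<subseteq> Pi\<^sub>E UNIV (\<lambda>_. {..d})"
  proof
    fix \<alpha> :: "'n \<Rightarrow> nat"
    assume "\<alpha> \<in> {\<alpha>. (\<Sum>j\<in>UNIV. \<alpha> j) \<le> d}"
    moreover have "\<alpha> j \<le> (\<Sum>j\<in>UNIV. \<alpha> j)" for j
      by (rule member_le_sum) auto
    ultimately have "\<alpha> j \<le> d" for j
      by (metis mem_Collect_eq order_trans)
    then show "\<alpha> \<in> Pi\<^sub>E UNIV (\<lambda>_. {..d})"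
      by (simp add: PiE_UNIV_domain)
  qed
qed (simp add: finite_PiE)

instance multi_index :: (finite, finite) finite
proof
  have "finite (range (exponent :: ('a, 'b) multi_index \<Rightarrow> _))"
    unfolding type_definition.Rep_range[OF type_definition_multi_index]
    by (rule finite_multi_indices)
  then show "finite (UNIV :: ('a, 'b) multi_index set)"
    by (rule finite_imageD) (simp add: inj_on_def exponent_inject)
qed

lemma card_multi_index:
  "CARD(('n::finite, 'd::finite) multi_index) =
    card {\<alpha> :: 'n \<Rightarrow> nat. (\<Sum>j\<in>UNIV. \<alpha> j) \<le> CARD('d)}"
  by (rule type_definition.card[OF type_definition_multi_index])

definition poly_of_coeffs ::
    "real ^ 'n::finite \<Rightarrow> real ^ ('n, 'd::finite) multi_index \<Rightarrow> real" where
  "poly_of_coeffs x c = (\<Sum>\<alpha>\<in>UNIV. c $ \<alpha> * (\<Prod>j\<in>UNIV. x $ j ^ exponent \<alpha> j))"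

definition poly_map ::
    "real ^ 'n::finite \<Rightarrow> real ^ ('n, 'd::finite) multi_index ^ 'r::finite \<Rightarrow> real ^ 'r" where
  "poly_map x u = (\<chi> i. poly_of_coeffs x (u $ i))"

definition continuous_selections ::
    "('a::topological_space \<Rightarrow> real ^ 'r::finite) \<Rightarrow> ('a \<Rightarrow> real) set" where
  "continuous_selections F = {f. continuous_on UNIV f \<and> (\<forall>x. f x \<in> {F x $ i | i. True})}"

(* The base point y tends to x without excluding y = x, hence nhds rather than at; the limsup
   is taken in the extended reals and is finite for locally Lipschitz f. *)
definition clarke_derivative ::
    "('a::euclidean_space \<Rightarrow> real) \<Rightarrow> 'a \<Rightarrow> 'a \<Rightarrow> ereal" where
  "clarke_derivative f x v =
    Limsup (nhds x \<times>\<^sub>F at_right (0::real)) (\<lambda>(y, t). ereal ((f (y + t *\<^sub>R v) - f y) / t))"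

definition clarke_subdifferential ::
    "('a::euclidean_space \<Rightarrow> real) \<Rightarrow> 'a \<Rightarrow> 'a set" where
  "clarke_subdifferential f x = {\<zeta>. \<forall>v. ereal (\<zeta> \<bullet> v) \<le> clarke_derivative f x v}"

definition critical_point :: "('a::euclidean_space \<Rightarrow> real) \<Rightarrow> 'a \<Rightarrow> bool" where
  "critical_point f x \<longleftrightarrow> 0 \<in> clarke_subdifferential f x"

definition Crit :: "('a::euclidean_space \<Rightarrow> real) set \<Rightarrow> 'a set" where
  "Crit C = {x. \<exists>f\<in>C. critical_point f x}"

(* Finite unions of sets given by finitely many polynomial equations and strict inequalities.
   On a Euclidean space real_polynomial_function singles out exactly the polynomials in the
   coordinates. *)
definition semialgebraic :: "'a::euclidean_space set \<Rightarrow> bool" where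
  "semialgebraic S \<longleftrightarrow>
    (\<exists>\<A> :: (('a \<Rightarrow> real) set \<times> ('a \<Rightarrow> real) set) set.
      finite \<A> \<and>
      (\<forall>(P, Q)\<in>\<A>. finite P \<and> finite Q \<and> (\<forall>p\<in>P \<union> Q. real_polynomial_function p)) \<and>
      S = (\<Union>(P, Q)\<in>\<A>. {x. (\<forall>p\<in>P. p x = 0) \<and> (\<forall>q\<in>Q. q x > 0)}))"

end

(*
The proof constructs a nonzero polynomial in the coefficients u that vanishes on every bad u.

If x is a Clarke critical point of a continuous selection, then 0 is a convex combination of the
gradients of the active polynomials: otherwise a separating direction would be a direction of
strict descent for every active piece, hence for the selection. So a bad u comes with points
x, y, a common value t, index sets I, J and multipliers l, m such that f_i(x) = t for i in I,
f_j(y) = t for j in J, and the gradients at x and at y are annihilated by l and m. These are one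
more equation than there are parameters (x, y, t, l, m), and they are linear in u.

On each of finitely many pieces the equations can be solved explicitly: all coordinates of u are
rational functions of fewer than dim(u) generators. Counting monomials, such coordinates satisfy a
nontrivial polynomial relation, so no projection theorem for semialgebraic sets and no Sard theorem
is needed. To solve the equations, the coefficients of f_i are traded for its values and slopes at
the two points (Hermite interpolation). This data is independent only for d >= 3; for d = 1 and
d = 2 the linear relations among it have to be dealt with by a case distinction.
*)
theory Submission
  imports Defs
begin

section \<open>Thin sets\<close>

text \<open>The witnesses x, y, t, l, m of a bad u depend on u in no regular way. This is harmless,
  because algebraic dependence is obtained by counting for functions on an arbitrary set: each
  coordinate of u only has to be, pointwise, a rational expression in the chosen functions. A piece
  fixes I, J, a coordinate e with x_e \<noteq> y_e, and indices i0 \<in> I, j0 \<in> J where the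
  multipliers are scaled to 1; the interpolation divides by powers of x_e - y_e only. For d \<ge> 3
  the generators number at most dim(u) - 1. For d = 2 the trapezoidal rule 2 (f(x) - f(y)) = (grad
  f(x) + grad f(y)) . (x - y) makes the e-slopes at y redundant, so criticality at y along e no
  longer eliminates one of them and the count is short by one. If the supports or the multipliers at
  x and y differ, that equation can be rewritten as a condition on the data at x; if they agree, one
  set of multipliers serves for both points. For d = 1 the gradients are constant, and the argument
  depends on how card I and card J compare with n.\<close>

definition thin :: "'a::euclidean_space set \<Rightarrow> bool" where
  "thin T \<longleftrightarrow> (\<exists>P. real_polynomial_function P \<and> (\<exists>v. P v \<noteq> 0) \<and> (\<forall>u\<in>T. P u = 0))"

text \<open>On the line from an arbitrary point u to v the polynomial becomes univariate and is
  nonzero at v, so it has finitely many zeros there; points of the line close to u avoid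
  them.\<close>

lemma closure_real_polynomial_nonzero:
  fixes P :: "'a::euclidean_space \<Rightarrow> real"
  assumes "real_polynomial_function P" "P v \<noteq> 0"
  shows "closure {u. P u \<noteq> 0} = UNIV"
proof -
  have "u \<in> closure {u. P u \<noteq> 0}" for u
  proof -
    define g where "g = (\<lambda>s::real. u + s *\<^sub>R (v - u))"
    have "polynomial_function g"
      unfolding g_def
      by (intro polynomial_function_add polynomial_function_mult polynomial_function_const
          polynomial_function_id real_polynomial_function.intros(1) bounded_linear_ident)
    then have "real_polynomial_function (P \<circ> g)"
      using assms(1) by (simp add: real_polynomial_function_compose)
    then obtain a n where a: "P \<circ> g = (\<lambda>x. \<Sum>i\<le>n. a i * x ^ i)"
      by (metis real_polynomial_function_iff_sum)
    have "(\<Sum>i\<le>n. a i * 1 ^ i) \<noteq> 0"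
      using assms(2) fun_cong[OF a, of 1] by (simp add: g_def)
    then obtain i where "i \<le> n" "a i \<noteq> 0"
      by (metis (no_types, lifting) atMost_iff mult_zero_left sum.neutral)
    then have fin: "finite {s. (P \<circ> g) s = 0}"
      unfolding a using polyfun_rootbound_finite by blast
    have lim: "((\<lambda>s. g s) \<longlongrightarrow> u) (at_right 0)"
      unfolding g_def by (auto intro!: tendsto_eq_intros)
    have "\<forall>\<^sub>F s in at_right (0::real). s \<notin> {s. (P \<circ> g) s = 0} - {0}"
    proof -
      have "open (- ({s. (P \<circ> g) s = 0} - {0}))"
        using fin by (intro open_Compl finite_imp_closed) auto
      then have "\<forall>\<^sub>F s in nhds 0. s \<in> - ({s. (P \<circ> g) s = 0} - {0})"
        by (intro eventually_nhds_in_open) auto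
      then show ?thesis
        unfolding eventually_at_filter by (rule eventually_mono) auto
    qed
    moreover have "\<forall>\<^sub>F s in at_right (0::real). s \<noteq> 0"
      by (simp add: eventually_at_filter)
    ultimately have "\<forall>\<^sub>F s in at_right 0. g s \<in> {u. P u \<noteq> 0}"
      by eventually_elim auto
    then have "\<forall>\<^sub>F s in at_right 0. g s \<in> closure {u. P u \<noteq> 0}"
      by (rule eventually_mono) (rule subsetD[OF closure_subset])
    then show ?thesis
      by (rule Lim_in_closed_set[OF closed_closure _ trivial_limit_at_right_real lim])
  qed
  then show ?thesis by blast
qed

lemma open_real_polynomial_nonzero:
  fixes P :: "'a::euclidean_space \<Rightarrow> real"
  assumes "real_polynomial_function P"
  shows "open {u. P u \<noteq> 0}"
proof -
  have "continuous_on UNIV P"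
    using assms by (simp add: continuous_on_polymonial_function real_polynomial_function_eq)
  then have "open (P -` (- {0}))"
    by (intro open_vimage) auto
  then show ?thesis by (simp add: vimage_def)
qed

lemma thin_empty: "thin {}"
  unfolding thin_def by (rule exI[of _ "\<lambda>_. 1"]) auto

lemma thin_subset: "thin T \<Longrightarrow> S \<subseteq> T \<Longrightarrow> thin S"
  unfolding thin_def by blast

text \<open>The product of the two polynomials works: it is not identically zero because a nonempty
  open set meets a dense one.\<close>

lemma thin_Un:
  assumes "thin S" "thin T"
  shows "thin (S \<union> T)"
proof -
  obtain P p where P: "real_polynomial_function P" "P p \<noteq> 0" "\<forall>u\<in>S. P u = 0"
    using assms(1) unfolding thin_def by auto
  obtain Q q where Q: "real_polynomial_function Q" "Q q \<noteq> 0" "\<forall>u\<in>T. Q u = 0"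
    using assms(2) unfolding thin_def by auto
  have "{u. P u \<noteq> 0} \<inter> {u. Q u \<noteq> 0} \<noteq> {}"
    using closure_real_polynomial_nonzero[OF P(1,2)] open_real_polynomial_nonzero[OF Q(1)] Q(2)
    by (metis (mono_tags, lifting) Int_commute empty_iff mem_Collect_eq
        open_Int_closure_eq_empty inf_top.right_neutral)
  then obtain w where "P w * Q w \<noteq> 0" by auto
  then show ?thesis
    unfolding thin_def using P Q
    by (intro exI[of _ "\<lambda>u. P u * Q u"]) auto
qed

lemma thin_UN: "finite A \<Longrightarrow> (\<And>a. a \<in> A \<Longrightarrow> thin (T a)) \<Longrightarrow> thin (\<Union>a\<in>A. T a)"
  by (induction A rule: finite_induct) (auto intro: thin_empty thin_Un)

lemma thin_imp_open_dense_semialgebraic: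
  fixes T :: "'a::euclidean_space set"
  assumes "thin T"
  obtains U where "open U" "closure U = UNIV" "semialgebraic U" "U \<inter> T = {}"
proof -
  obtain P v where P: "real_polynomial_function P" "P v \<noteq> 0" "\<forall>u\<in>T. P u = 0"
    using assms unfolding thin_def by auto
  \<comment> \<open>A single strict inequality suffices, P u * P u > 0.\<close>
  have "semialgebraic {u. P u \<noteq> 0}"
    unfolding semialgebraic_def
    by (rule exI[of _ "{({}, {\<lambda>u. P u * P u})}"])
      (auto intro: P(1) simp: zero_less_mult_iff neq_iff)
  with P show ?thesis
    using that[of "{u. P u \<noteq> 0}"] open_real_polynomial_nonzero closure_real_polynomial_nonzero
    by blast
qed

section \<open>Algebraic dependence of too many rational functions\<close>

text \<open>Gaussian elimination for a homogeneous system in which \<open>A\<close> indexes the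
  unknowns and \<open>B\<close> the equations.\<close>

lemma ex_nontrivial_solution:
  fixes M :: "'a \<Rightarrow> 'b \<Rightarrow> real"
  assumes "finite B" "finite A" "card B < card A"
  shows "\<exists>c. (\<exists>a\<in>A. c a \<noteq> 0) \<and> (\<forall>b\<in>B. (\<Sum>a\<in>A. c a * M a b) = 0)"
  using assms
proof (induction B arbitrary: A M rule: finite_induct)
  case empty
  then obtain a where "a \<in> A" by fastforce
  then show ?case by (intro exI[of _ "\<lambda>_. 1"]) auto
next
  case (insert b B)
  show ?case
  proof (cases "\<forall>a\<in>A. M a b = 0")
    case True
    obtain c where "\<exists>a\<in>A. c a \<noteq> 0" "\<forall>b\<in>B. (\<Sum>a\<in>A. c a * M a b) = 0"
      using insert.IH[of A M] insert.prems insert.hyps by auto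
    with True show ?thesis by (intro exI[of _ c]) auto
  next
    case False
    then obtain p where p: "p \<in> A" "M p b \<noteq> 0" by blast
    \<comment> \<open>Equation b is solved for the unknown p; \<open>M'\<close> is the system that
      remains after substitution, and \<open>c'\<close> below is the back substitution.\<close>
    define A' where "A' = A - {p}"
    define M' where "M' = (\<lambda>a b'. M a b' - M a b / M p b * M p b')"
    have A: "A = insert p A'" "p \<notin> A'" "finite A'"
      using p insert.prems by (auto simp: A'_def)
    then have "card B < card A'"
      using insert.prems insert.hyps by auto
    then obtain c where c: "\<exists>a\<in>A'. c a \<noteq> 0" "\<forall>b\<in>B. (\<Sum>a\<in>A'. c a * M' a b) = 0"
      using insert.IH[of A' M'] A(3) by auto
    define c' where "c' = c(p := - (\<Sum>a\<in>A'. c a * M a b) / M p b)"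
    have "(\<Sum>a\<in>A. c' a * M a b') = (\<Sum>a\<in>A'. c a * M' a b')" for b'
    proof -
      have "(\<Sum>a\<in>A. c' a * M a b') = c' p * M p b' + (\<Sum>a\<in>A'. c' a * M a b')"
        using A by simp
      also have "(\<Sum>a\<in>A'. c' a * M a b') = (\<Sum>a\<in>A'. c a * M a b')"
        using A(2) by (intro sum.cong) (auto simp: c'_def)
      also have "c' p * M p b' = - (\<Sum>a\<in>A'. c a * (M a b / M p b * M p b'))"
        by (simp add: c'_def sum_divide_distrib sum_distrib_right mult.assoc)
      finally show ?thesis
        by (simp add: M'_def right_diff_distrib sum_subtractf)
    qed
    moreover have "(\<Sum>a\<in>A'. c a * M' a b) = 0"
      using p by (simp add: M'_def)
    moreover have "\<exists>a\<in>A. c' a \<noteq> 0"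
      using c(1) A by (auto simp: c'_def)
    ultimately show ?thesis
      using c(2) by (intro exI[of _ c']) auto
  qed
qed

text \<open>Induction on the variables: the polynomial is read as one in the new variable, with
  coefficients \<open>q j\<close> that are polynomials in the others.\<close>

lemma monomials_independent:
  fixes c :: "('b \<Rightarrow> nat) \<Rightarrow> real"
  assumes "finite X" "\<And>v. (\<Sum>k\<in>PiE X (\<lambda>_. {..D}). c k * (\<Prod>b\<in>X. v b ^ k b)) = 0"
    "k \<in> PiE X (\<lambda>_. {..D})"
  shows "c k = 0"
  using assms
proof (induction X arbitrary: c k rule: finite_induct)
  case empty
  then show ?case by auto
next
  case (insert x X)
  define q where "q = (\<lambda>j v. \<Sum>k\<in>PiE X (\<lambda>_. {..D}). c (k(x := j)) * (\<Prod>b\<in>X. v b ^ k b))"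
  have expand: "(\<Sum>k\<in>PiE (insert x X) (\<lambda>_. {..D}). c k * (\<Prod>b\<in>insert x X. v b ^ k b))
      = (\<Sum>j\<le>D. q j v * v x ^ j)" for v
  proof -
    have "(\<Sum>k\<in>PiE (insert x X) (\<lambda>_. {..D}). c k * (\<Prod>b\<in>insert x X. v b ^ k b))
        = (\<Sum>(j, k)\<in>{..D} \<times> PiE X (\<lambda>_. {..D}). c (k(x := j)) * (\<Prod>b\<in>insert x X. v b ^ (k(x := j)) b))"
      unfolding PiE_insert_eq
      by (subst sum.reindex[OF inj_combinator[OF insert.hyps(2)]]) (simp add: case_prod_unfold)
    also have "\<dots> = (\<Sum>(j, k)\<in>{..D} \<times> PiE X (\<lambda>_. {..D}). c (k(x := j)) * (\<Prod>b\<in>X. v b ^ k b) * v x ^ j)"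
    proof (intro sum.cong refl, clarify)
      fix j k
      have "(\<Prod>b\<in>X. v b ^ (k(x := j)) b) = (\<Prod>b\<in>X. v b ^ k b)"
        using insert.hyps by (intro prod.cong) auto
      then show "c (k(x := j)) * (\<Prod>b\<in>insert x X. v b ^ (k(x := j)) b)
          = c (k(x := j)) * (\<Prod>b\<in>X. v b ^ k b) * v x ^ j"
        using insert.hyps by simp
    qed
    finally show ?thesis
      by (simp add: sum.cartesian_product q_def sum_distrib_right)
  qed
  have q0: "q j v = 0" if "j \<le> D" for j v
  proof -
    have "(\<Sum>j\<le>D. q j v * y ^ j) = 0" for y
    proof -
      \<comment> \<open>\<open>q j\<close> does not involve the variable x, so x can run through all
        reals while the coefficients stay fixed.\<close>
      have "q j (v(x := y)) = q j v" for j
        unfolding q_def using insert.hyps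
        by (intro sum.cong refl arg_cong2[of _ _ _ _ "(*)"] prod.cong) auto
      then show ?thesis
        using insert.prems(1)[of "v(x := y)"] unfolding expand by (simp only: fun_upd_same)
    qed
    then show ?thesis
      using polyfun_eq_0[of "\<lambda>j. q j v" D] that by blast
  qed
  from insert.prems(2) obtain j k' where
    k: "k = k'(x := j)" "j \<le> D" "k' \<in> PiE X (\<lambda>_. {..D})"
    unfolding PiE_insert_eq by auto
  show ?case
    unfolding k(1) using insert.IH[of "\<lambda>k. c (k(x := j))" k'] q0[OF k(2)] k(3)
    unfolding q_def by blast
qed

text \<open>Bounding the degree in each generator separately makes the number of monomials (e +
  1)^card Z. The generators are functions rather than formal variables; relations among them do no
  harm, as only an upper bound on this number matters.\<close>

inductive_set bounded_poly :: "('s \<Rightarrow> real) set \<Rightarrow> nat \<Rightarrow> ('s \<Rightarrow> real) set"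
  for Z :: "('s \<Rightarrow> real) set" and e :: nat where
  zero: "(\<lambda>_. 0) \<in> bounded_poly Z e"
| add_monomial: "f \<in> bounded_poly Z e \<Longrightarrow> \<forall>z\<in>Z. k z \<le> e \<Longrightarrow>
    (\<lambda>s. f s + c * (\<Prod>z\<in>Z. z s ^ k z)) \<in> bounded_poly Z e"

lemma bounded_poly_mono: "f \<in> bounded_poly Z e \<Longrightarrow> e \<le> e' \<Longrightarrow> f \<in> bounded_poly Z e'"
  by (induction rule: bounded_poly.induct)
    (auto intro!: bounded_poly.intros dest: order_trans)

lemma bounded_poly_monomial:
  "\<forall>z\<in>Z. k z \<le> e \<Longrightarrow> (\<lambda>s. c * (\<Prod>z\<in>Z. z s ^ k z)) \<in> bounded_poly Z e"
  using bounded_poly.add_monomial[OF bounded_poly.zero, of Z k e c] by simp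

lemma bounded_poly_const: "(\<lambda>_. c) \<in> bounded_poly Z e"
  using bounded_poly_monomial[of Z "\<lambda>_. 0" e c] by simp

lemma bounded_poly_generator: "finite Z \<Longrightarrow> z \<in> Z \<Longrightarrow> z \<in> bounded_poly Z 1"
proof -
  assume z: "finite Z" "z \<in> Z"
  have "(\<Prod>w\<in>Z. w s ^ of_bool (w = z)) = z s" for s
  proof -
    have "(\<Prod>w\<in>Z. w s ^ of_bool (w = z)) = (\<Prod>w\<in>Z. if w = z then z s else 1)"
      by (intro prod.cong) auto
    then show ?thesis using z by simp
  qed
  then show ?thesis
    using bounded_poly_monomial[of Z "\<lambda>w. of_bool (w = z)" 1 1] by simp
qed

lemma bounded_poly_add:
  "g \<in> bounded_poly Z e \<Longrightarrow> f \<in> bounded_poly Z e \<Longrightarrow> (\<lambda>s. f s + g s) \<in> bounded_poly Z e"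
proof (induction g rule: bounded_poly.induct)
  case zero
  then show ?case by simp
next
  case (add_monomial g k c)
  then show ?case
    using bounded_poly.add_monomial[of "\<lambda>s. f s + g s" Z e k c] by (simp add: add.assoc)
qed

lemma bounded_poly_mult_monomial:
  assumes "f \<in> bounded_poly Z e" "\<forall>z\<in>Z. k z \<le> e'"
  shows "(\<lambda>s. f s * (c * (\<Prod>z\<in>Z. z s ^ k z))) \<in> bounded_poly Z (e + e')"
  using assms(1)
proof (induction f rule: bounded_poly.induct)
  case zero
  show ?case using bounded_poly.zero by simp
next
  case (add_monomial f k' c')
  have "\<forall>z\<in>Z. k' z + k z \<le> e + e'"
    using add_monomial(2) assms(2) by (simp add: add_mono)
  from bounded_poly.add_monomial[OF add_monomial.IH this, of "c' * c"] show ?case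
    by (simp add: algebra_simps power_add prod.distrib)
qed

lemma bounded_poly_mult:
  "g \<in> bounded_poly Z e' \<Longrightarrow> f \<in> bounded_poly Z e \<Longrightarrow> (\<lambda>s. f s * g s) \<in> bounded_poly Z (e + e')"
proof (induction g rule: bounded_poly.induct)
  case zero
  show ?case using bounded_poly.zero by simp
next
  case (add_monomial g k c)
  then show ?case
    using bounded_poly_add[OF bounded_poly_mult_monomial[of f Z e k e' c], of "\<lambda>s. f s * g s"]
    by (simp add: distrib_left)
qed

lemma bounded_poly_power: "f \<in> bounded_poly Z e \<Longrightarrow> (\<lambda>s. f s ^ k) \<in> bounded_poly Z (e * k)"
  by (induction k) (auto simp: bounded_poly_const intro: bounded_poly_mult)

lemma bounded_poly_prod:
  assumes "finite B" "\<And>b. b \<in> B \<Longrightarrow> f b \<in> bounded_poly Z e"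
  shows "(\<lambda>s. \<Prod>b\<in>B. f b s) \<in> bounded_poly Z (card B * e)"
  using assms
proof (induction B rule: finite_induct)
  case empty
  then show ?case by (simp add: bounded_poly_const)
next
  case (insert b B)
  then show ?case
    using bounded_poly_mult[of "\<lambda>s. \<Prod>b\<in>B. f b s" Z "card B * e" "f b" e] by simp
qed

lemma bounded_poly_coefficients:
  assumes "f \<in> bounded_poly Z e" "finite Z"
  shows "\<exists>c. \<forall>s. f s = (\<Sum>k\<in>PiE Z (\<lambda>_. {..e}). c k * (\<Prod>z\<in>Z. z s ^ k z))"
  using assms(1)
proof (induction f rule: bounded_poly.induct)
  case zero
  show ?case by (rule exI[of _ "\<lambda>_. 0"]) simp
next
  case (add_monomial f k a)
  then obtain c where c: "\<forall>s. f s = (\<Sum>k\<in>PiE Z (\<lambda>_. {..e}). c k * (\<Prod>z\<in>Z. z s ^ k z))"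
    by blast
  \<comment> \<open>The exponent matters on \<open>Z\<close> only; restriction selects its
    representative in the index set of the sum.\<close>
  define r where "r = restrict k Z"
  have r: "r \<in> PiE Z (\<lambda>_. {..e})" "finite (PiE Z (\<lambda>_. {..e}))"
    using add_monomial(2) assms(2) by (auto simp: r_def finite_PiE)
  have "(\<Prod>z\<in>Z. z s ^ k z) = (\<Prod>z\<in>Z. z s ^ r z)" for s
    by (intro prod.cong) (auto simp: r_def)
  then have "f s + a * (\<Prod>z\<in>Z. z s ^ k z)
      = (\<Sum>k\<in>PiE Z (\<lambda>_. {..e}). (c(r := c r + a)) k * (\<Prod>z\<in>Z. z s ^ k z))" for s
    using r by (simp add: c sum.remove[of _ r] distrib_right)
  then show ?case by blast
qed

text \<open>The rule \<open>cong\<close> makes membership depend on the values on S alone, since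
  functions obtained by choice are arbitrary elsewhere. For the same reason denominators have to be
  nonzero on S only.\<close>

inductive_set ratfun :: "'s set \<Rightarrow> ('s \<Rightarrow> real) set \<Rightarrow> ('s \<Rightarrow> real) set"
  for S :: "'s set" and Z :: "('s \<Rightarrow> real) set" where
  generator: "z \<in> Z \<Longrightarrow> z \<in> ratfun S Z"
| const: "(\<lambda>_. c) \<in> ratfun S Z"
| add: "f \<in> ratfun S Z \<Longrightarrow> g \<in> ratfun S Z \<Longrightarrow> (\<lambda>s. f s + g s) \<in> ratfun S Z"
| mult: "f \<in> ratfun S Z \<Longrightarrow> g \<in> ratfun S Z \<Longrightarrow> (\<lambda>s. f s * g s) \<in> ratfun S Z"
| inverse: "f \<in> ratfun S Z \<Longrightarrow> \<forall>s\<in>S. f s \<noteq> 0 \<Longrightarrow> (\<lambda>s. inverse (f s)) \<in> ratfun S Z"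
| cong: "f \<in> ratfun S Z \<Longrightarrow> \<forall>s\<in>S. g s = f s \<Longrightarrow> g \<in> ratfun S Z"

lemma ratfun_minus: "f \<in> ratfun S Z \<Longrightarrow> (\<lambda>s. - f s) \<in> ratfun S Z"
  using ratfun.mult[OF ratfun.const[of "-1"]] by simp

lemma ratfun_diff: "f \<in> ratfun S Z \<Longrightarrow> g \<in> ratfun S Z \<Longrightarrow> (\<lambda>s. f s - g s) \<in> ratfun S Z"
  using ratfun.add[OF _ ratfun_minus] by simp

lemma ratfun_divide:
  "f \<in> ratfun S Z \<Longrightarrow> g \<in> ratfun S Z \<Longrightarrow> \<forall>s\<in>S. g s \<noteq> 0 \<Longrightarrow> (\<lambda>s. f s / g s) \<in> ratfun S Z"
  using ratfun.mult[OF _ ratfun.inverse] by (simp add: divide_inverse)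

lemma ratfun_power: "f \<in> ratfun S Z \<Longrightarrow> (\<lambda>s. f s ^ k) \<in> ratfun S Z"
  by (induction k) (auto intro: ratfun.intros)

lemma ratfun_sum: "(\<And>a. a \<in> A \<Longrightarrow> f a \<in> ratfun S Z) \<Longrightarrow> (\<lambda>s. \<Sum>a\<in>A. f a s) \<in> ratfun S Z"
  by (induction A rule: infinite_finite_induct) (auto intro: ratfun.intros)

lemma ratfun_prod: "(\<And>a. a \<in> A \<Longrightarrow> f a \<in> ratfun S Z) \<Longrightarrow> (\<lambda>s. \<Prod>a\<in>A. f a s) \<in> ratfun S Z"
  by (induction A rule: infinite_finite_induct) (auto intro: ratfun.intros)

lemmas ratfun_intros =
  ratfun.const ratfun.add ratfun.mult ratfun_minus ratfun_diff ratfun_power ratfun_sum ratfun_prod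

text \<open>Numerator and denominator share one degree bound, which keeps the later count
  uniform.\<close>

lemma ratfun_fraction:
  assumes "f \<in> ratfun S Z" "finite Z"
  shows "\<exists>e. \<exists>a\<in>bounded_poly Z e. \<exists>b\<in>bounded_poly Z e. \<forall>s\<in>S. a s \<noteq> 0 \<and> f s * a s = b s"
  using assms(1)
proof (induction f rule: ratfun.induct)
  case (generator z)
  then show ?case
    using bounded_poly_generator[OF assms(2)] bounded_poly_const[of 1]
    by (intro exI[of _ 1] bexI[of _ "\<lambda>_. 1"] bexI[of _ z]) auto
next
  case (const c)
  then show ?case
    by (intro exI[of _ 0] bexI[of _ "\<lambda>_. 1"] bexI[of _ "\<lambda>_. c"]) (auto intro: bounded_poly_const)
next
  case (add f g)
  then obtain e a b e' a' b' where *: "a \<in> bounded_poly Z e" "b \<in> bounded_poly Z e"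
    "\<forall>s\<in>S. a s \<noteq> 0 \<and> f s * a s = b s" "a' \<in> bounded_poly Z e'" "b' \<in> bounded_poly Z e'"
    "\<forall>s\<in>S. a' s \<noteq> 0 \<and> g s * a' s = b' s"
    by blast
  have "\<forall>s\<in>S. a s * a' s \<noteq> 0 \<and> (f s + g s) * (a s * a' s) = b s * a' s + a s * b' s"
  proof
    fix s assume "s \<in> S"
    then have "a s \<noteq> 0" "a' s \<noteq> 0" "b s = f s * a s" "b' s = g s * a' s"
      using * by auto
    then show "a s * a' s \<noteq> 0 \<and> (f s + g s) * (a s * a' s) = b s * a' s + a s * b' s"
      by (simp add: algebra_simps)
  qed
  moreover have "(\<lambda>s. a s * a' s) \<in> bounded_poly Z (e + e')"
    "(\<lambda>s. b s * a' s + a s * b' s) \<in> bounded_poly Z (e + e')"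
    using * by (auto intro!: bounded_poly_add bounded_poly_mult)
  ultimately show ?case
    by (intro exI[of _ "e + e'"] bexI[of _ "\<lambda>s. a s * a' s"]
        bexI[of _ "\<lambda>s. b s * a' s + a s * b' s"]) auto
next
  case (mult f g)
  then obtain e a b e' a' b' where *: "a \<in> bounded_poly Z e" "b \<in> bounded_poly Z e"
    "\<forall>s\<in>S. a s \<noteq> 0 \<and> f s * a s = b s" "a' \<in> bounded_poly Z e'" "b' \<in> bounded_poly Z e'"
    "\<forall>s\<in>S. a' s \<noteq> 0 \<and> g s * a' s = b' s"
    by blast
  have "\<forall>s\<in>S. a s * a' s \<noteq> 0 \<and> (f s * g s) * (a s * a' s) = b s * b' s"
  proof
    fix s assume "s \<in> S"
    then have "a s \<noteq> 0" "a' s \<noteq> 0" "b s = f s * a s" "b' s = g s * a' s"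
      using * by auto
    then show "a s * a' s \<noteq> 0 \<and> (f s * g s) * (a s * a' s) = b s * b' s"
      by (simp add: algebra_simps)
  qed
  moreover have "(\<lambda>s. a s * a' s) \<in> bounded_poly Z (e + e')"
    "(\<lambda>s. b s * b' s) \<in> bounded_poly Z (e + e')"
    using * by (auto intro!: bounded_poly_mult)
  ultimately show ?case
    by (intro exI[of _ "e + e'"] bexI[of _ "\<lambda>s. a s * a' s"] bexI[of _ "\<lambda>s. b s * b' s"]) auto
next
  case (inverse f)
  then obtain e a b where *: "a \<in> bounded_poly Z e" "b \<in> bounded_poly Z e"
    "\<forall>s\<in>S. a s \<noteq> 0 \<and> f s * a s = b s" by blast
  have "\<forall>s\<in>S. b s \<noteq> 0 \<and> inverse (f s) * b s = a s"
  proof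
    fix s assume "s \<in> S"
    then have "a s \<noteq> 0" "f s \<noteq> 0" "b s = f s * a s" using * inverse.hyps by auto
    then show "b s \<noteq> 0 \<and> inverse (f s) * b s = a s" by simp
  qed
  with * show ?case by blast
next
  case (cong f g)
  then show ?case by auto
qed

text \<open>There are (D + 1)^DIM monomials of degree at most D in each coordinate. After clearing
  denominators they lie in a space whose dimension grows only like D^card Z, so for large D a
  nontrivial combination of them vanishes on the image.\<close>

lemma thin_image_ratfun:
  fixes U :: "'s \<Rightarrow> 'a::euclidean_space"
  assumes Z: "finite Z" "card Z < DIM('a)"
    and U: "\<And>b. b \<in> Basis \<Longrightarrow> (\<lambda>s. U s \<bullet> b) \<in> ratfun S Z"
  shows "thin (U ` S)"
proof -
  have "\<forall>b\<in>Basis. \<exists>e. \<exists>p\<in>bounded_poly Z e. \<exists>q\<in>bounded_poly Z e. \<forall>s\<in>S. p s \<noteq> 0 \<and> (U s \<bullet> b) * p s = q s"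
    using ratfun_fraction[OF U Z(1)] by blast
  then obtain E p q where
    pq: "\<And>b. b \<in> Basis \<Longrightarrow> p b \<in> bounded_poly Z (E b)" "\<And>b. b \<in> Basis \<Longrightarrow> q b \<in> bounded_poly Z (E b)"
      "\<And>b s. b \<in> Basis \<Longrightarrow> s \<in> S \<Longrightarrow> p b s \<noteq> 0 \<and> (U s \<bullet> b) * p b s = q b s"
    by metis
  define e where "e = Max (E ` Basis)"
  have e: "p b \<in> bounded_poly Z e" "q b \<in> bounded_poly Z e" if "b \<in> Basis" for b
    using pq(1,2)[OF that] that by (auto simp: e_def intro: bounded_poly_mono)
  define N where "N = DIM('a)"
  \<comment> \<open>These choices give (N * e * D + 1)^card Z \<le> (C * (D + 1))^card Z = D * (D +
    1)^card Z < (D + 1)^(card Z + 1), which is at most (D + 1)^N.\<close>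
  define C where "C = N * e + 1"
  define D where "D = C ^ card Z"
  define A where "A = PiE (Basis :: 'a set) (\<lambda>_. {..D})"
  define B where "B = PiE Z (\<lambda>_. {..N * (e * D)})"
  have fin: "finite A" "finite B"
    using Z by (auto simp: A_def B_def finite_PiE)
  have "card B < card A"
  proof -
    have "card B = (N * (e * D) + 1) ^ card Z"
      using Z by (simp add: B_def card_PiE)
    also have "\<dots> \<le> (C * (D + 1)) ^ card Z"
      by (intro power_mono) (auto simp: C_def algebra_simps)
    also have "\<dots> = D * (D + 1) ^ card Z"
      by (simp only: power_mult_distrib D_def)
    also have "\<dots> < (D + 1) ^ Suc (card Z)"
      by simp
    also have "\<dots> \<le> (D + 1) ^ N"
      using Z by (intro power_increasing) (auto simp: N_def)
    also have "\<dots> = card A"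
      by (simp add: A_def card_PiE N_def)
    finally show ?thesis .
  qed
  \<comment> \<open>\<open>G k\<close> is the monomial with exponent k at U s, multiplied by the
    product of all p b s ^ D. This factor clears the denominators for every k at once.\<close>
  define G where "G = (\<lambda>k s. \<Prod>b\<in>Basis. q b s ^ k b * p b s ^ (D - k b))"
  have "G k \<in> bounded_poly Z (N * (e * D))" if "k \<in> A" for k
    unfolding G_def N_def
  proof (intro bounded_poly_prod finite_Basis)
    fix b :: 'a assume b: "b \<in> Basis"
    have "k b \<le> D" using that b by (auto simp: A_def)
    then have "e * k b + e * (D - k b) = e * D"
      by (metis distrib_left le_add_diff_inverse)
    then show "(\<lambda>s. q b s ^ k b * p b s ^ (D - k b)) \<in> bounded_poly Z (e * D)"
      using bounded_poly_mult[OF bounded_poly_power[OF e(1)[OF b]] bounded_poly_power[OF e(2)[OF b]]]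
      by metis
  qed
  then have "\<forall>k\<in>A. \<exists>c. \<forall>s. G k s = (\<Sum>j\<in>B. c j * (\<Prod>z\<in>Z. z s ^ j z))"
    unfolding B_def using bounded_poly_coefficients[OF _ Z(1)] by blast
  from bchoice[OF this] obtain M
    where M: "\<And>k s. k \<in> A \<Longrightarrow> G k s = (\<Sum>j\<in>B. M k j * (\<Prod>z\<in>Z. z s ^ j z))"
    by blast
  \<comment> \<open>One unknown for each monomial in the coordinates, one equation for each monomial
    in the generators.\<close>
  obtain c k0 where c: "k0 \<in> A" "c k0 \<noteq> 0" "\<And>j. j \<in> B \<Longrightarrow> (\<Sum>k\<in>A. c k * M k j) = 0"
    using ex_nontrivial_solution[OF fin(2,1) \<open>card B < card A\<close>, of M] by blast
  define P where "P = (\<lambda>v::'a. \<Sum>k\<in>A. c k * (\<Prod>b\<in>Basis. (v \<bullet> b) ^ k b))"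
  have "real_polynomial_function P"
    unfolding P_def
    by (intro real_polynomial_function_sum real_polynomial_function_prod
        real_polynomial_function_power real_polynomial_function.intros(4)
        real_polynomial_function.intros(2) real_polynomial_function.intros(1)
        bounded_linear_inner_left finite_Basis fin)
  moreover have "P (U s) = 0" if s: "s \<in> S" for s
  proof -
    have "P (U s) * (\<Prod>b\<in>Basis. p b s ^ D) = (\<Sum>k\<in>A. c k * G k s)"
    proof -
      have "(\<Prod>b\<in>Basis. (U s \<bullet> b) ^ k b) * (\<Prod>b\<in>Basis. p b s ^ D) = G k s" if "k \<in> A" for k
      proof -
        have "(U s \<bullet> b) ^ k b * p b s ^ D = q b s ^ k b * p b s ^ (D - k b)" if b: "b \<in> Basis" for b
        proof -
          have "k b \<le> D" using \<open>k \<in> A\<close> b by (auto simp: A_def)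
          then have "p b s ^ D = p b s ^ k b * p b s ^ (D - k b)"
            by (metis le_add_diff_inverse power_add)
          then show ?thesis
            using pq(3)[OF b s] by (metis mult.assoc power_mult_distrib)
        qed
        then show ?thesis by (simp add: G_def prod.distrib[symmetric])
      qed
      then show ?thesis
        unfolding P_def by (simp add: sum_distrib_right mult.assoc)
    qed
    also have "\<dots> = (\<Sum>j\<in>B. (\<Sum>k\<in>A. c k * M k j) * (\<Prod>z\<in>Z. z s ^ j z))"
    proof -
      have "(\<Sum>k\<in>A. c k * G k s) = (\<Sum>k\<in>A. \<Sum>j\<in>B. c k * M k j * (\<Prod>z\<in>Z. z s ^ j z))"
        by (intro sum.cong) (auto simp: M sum_distrib_left mult.assoc)
      also have "\<dots> = (\<Sum>j\<in>B. \<Sum>k\<in>A. c k * M k j * (\<Prod>z\<in>Z. z s ^ j z))"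
        by (rule sum.swap)
      finally show ?thesis by (simp add: sum_distrib_right)
    qed
    also have "\<dots> = 0" using c(3) by simp
    finally show ?thesis
      using pq(3)[OF _ s] by (auto simp: prod_zero_iff)
  qed
  moreover have "\<exists>v. P v \<noteq> 0"
  proof (rule ccontr)
    assume zero: "\<not> (\<exists>v. P v \<noteq> 0)"
    have "c k0 = 0"
    proof (rule monomials_independent[of "Basis :: 'a set" c D])
      fix w :: "'a \<Rightarrow> real"
      have "P (\<Sum>b\<in>Basis. w b *\<^sub>R b) = (\<Sum>k\<in>A. c k * (\<Prod>b\<in>Basis. w b ^ k b))"
        unfolding P_def by (intro sum.cong refl arg_cong2[of _ _ _ _ "(*)"] prod.cong) auto
      then show "(\<Sum>k\<in>PiE Basis (\<lambda>_. {..D}). c k * (\<Prod>b\<in>Basis. w b ^ k b)) = 0"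
        using zero by (simp add: A_def)
    qed (use c in \<open>auto simp: A_def\<close>)
    with c show False by simp
  qed
  ultimately show ?thesis
    unfolding thin_def by blast
qed

section \<open>Critical points of continuous selections\<close>

text \<open>Let s be the last point with h s \<le> h a. If s < b, then just to the right of s only
  pieces active at s can be selected; these do not rise above h s, which contradicts the choice of
  s.\<close>

lemma continuous_selection_of_antimono:
  fixes h :: "real \<Rightarrow> real" and H :: "'i \<Rightarrow> real \<Rightarrow> real"
  assumes fin: "finite A" and ab: "a \<le> b"
    and h: "continuous_on {a..b} h" "\<And>s. s \<in> {a..b} \<Longrightarrow> \<exists>i\<in>A. h s = H i s"
    and H: "\<And>i. i \<in> A \<Longrightarrow> continuous_on {a..b} (H i)"
      "\<And>i s s'. i \<in> A \<Longrightarrow> a \<le> s \<Longrightarrow> s \<le> s' \<Longrightarrow> s' \<le> b \<Longrightarrow> H i s' \<le> H i s"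
  shows "h b \<le> h a"
proof (rule ccontr)
  assume "\<not> h b \<le> h a"
  define T where "T = {s \<in> {a..b}. h s \<le> h a}"
  have "closed T"
    unfolding T_def by (intro continuous_on_closed_Collect_le h continuous_intros)
  moreover have "T \<noteq> {}" "bdd_above T"
    using ab by (auto simp: T_def bdd_above_def)
  ultimately have "Sup T \<in> T"
    by (meson closed_contains_Sup)
  define s where "s = Sup T"
  have s: "s \<in> {a..b}" "h s \<le> h a" "s < b"
    using \<open>Sup T \<in> T\<close> \<open>\<not> h b \<le> h a\<close> by (auto simp: T_def s_def less_le)
  have after: "h s' > h a" if "s < s'" "s' \<le> b" for s'
  proof (rule ccontr)
    assume "\<not> h s' > h a"
    then have "s' \<in> T" using that s by (auto simp: T_def)
    then show False
      using cSup_upper[OF _ \<open>bdd_above T\<close>] that by (fastforce simp: s_def)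
  qed
  have at: "at_right s \<le> at s within {a..b}"
  proof -
    have "at s within {s..b} \<le> at s within {a..b}"
      using s by (intro at_le) auto
    then show ?thesis
      using at_within_Icc_at_right[OF s(3)] by simp
  qed
  \<comment> \<open>By continuity a piece that differs from h at s still differs from it
    nearby.\<close>
  have "\<forall>\<^sub>F s' in at s within {a..b}. H i s' = h s' \<longrightarrow> H i s = h s" if "i \<in> A" for i
  proof (cases "H i s = h s")
    case False
    have "((\<lambda>s'. H i s' - h s') \<longlongrightarrow> H i s - h s) (at s within {a..b})"
      using h(1) H(1)[OF that] s(1) by (intro tendsto_diff) (auto simp: continuous_on_def)
    then have "\<forall>\<^sub>F s' in at s within {a..b}. H i s' - h s' \<noteq> 0"
      using False by (intro tendsto_imp_eventually_ne) auto
    then show ?thesis by (rule eventually_mono) auto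
  qed auto
  then have "\<forall>\<^sub>F s' in at s within {a..b}. \<forall>i\<in>A. H i s' = h s' \<longrightarrow> H i s = h s"
    using fin by (simp add: eventually_ball_finite)
  then have "\<forall>\<^sub>F s' in at_right s. \<forall>i\<in>A. H i s' = h s' \<longrightarrow> H i s = h s"
    using at by (rule filter_leD[rotated])
  moreover have "\<forall>\<^sub>F s' in at_right s. s' \<in> {s<..<b}"
    using s(3) by (rule eventually_at_rightI[rotated]) auto
  ultimately have "\<forall>\<^sub>F s' in at_right s. s' \<in> {s<..<b} \<and> (\<forall>i\<in>A. H i s' = h s' \<longrightarrow> H i s = h s)"
    by eventually_elim auto
  then obtain s' where s': "s < s'" "s' < b" "\<And>i. i \<in> A \<Longrightarrow> H i s' = h s' \<Longrightarrow> H i s = h s"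
    using eventually_happens'[OF trivial_limit_at_right_real] by fastforce
  obtain i where i: "i \<in> A" "h s' = H i s'"
    using h(2)[of s'] s s' by auto
  then have "h s' \<le> h s"
    using s'(3)[of i] H(2)[of i s s'] s s' by auto
  then show False
    using after[of s'] s s' by auto
qed

text \<open>The Clarke derivative lets the base point move, so the descent must be uniform near x.
  The neighbourhood \<open>V\<close> provides this: the bound c persists there for the active
  gradients, and pieces inactive at x cannot be selected.\<close>

lemma clarke_critical_imp_convex_combination:
  fixes f :: "'a::euclidean_space \<Rightarrow> real" and F :: "'i::finite \<Rightarrow> 'a \<Rightarrow> real"
    and G :: "'i \<Rightarrow> 'a \<Rightarrow> 'a"
  assumes f: "continuous_on UNIV f" "\<And>x. \<exists>i. f x = F i x"
    and F: "\<And>i x. (F i has_derivative (\<lambda>h. G i x \<bullet> h)) (at x)"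
    and G: "\<And>i. continuous_on UNIV (G i)"
    and crit: "critical_point f x"
  shows "0 \<in> convex hull ((\<lambda>i. G i x) ` {i. F i x = f x})"
proof (rule ccontr)
  define A where "A = {i. F i x = f x}"
  assume "0 \<notin> convex hull ((\<lambda>i. G i x) ` {i. F i x = f x})"
  then have "0 \<notin> convex hull ((\<lambda>i. G i x) ` A)"
    by (simp add: A_def)
  moreover have "closed (convex hull ((\<lambda>i. G i x) ` A))"
    by (intro compact_imp_closed finite_imp_compact_convex_hull) simp
  ultimately obtain w c where w: "c > 0" "\<And>i. i \<in> A \<Longrightarrow> w \<bullet> G i x > c"
    using separating_hyperplane_closed_0[of "convex hull ((\<lambda>i. G i x) ` A)"]
      hull_inc[of _ "(\<lambda>i. G i x) ` A" convex] convex_convex_hull by (metis imageI)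
  have contF: "continuous_on UNIV (F i)" for i
    by (intro continuous_at_imp_continuous_on ballI has_derivative_continuous[OF F])
  define V where "V = {y. (\<forall>i\<in>A. w \<bullet> G i y > c) \<and> (\<forall>i\<in>-A. F i y \<noteq> f y)}"
  have "open V"
  proof -
    have "V = (\<Inter>i\<in>A. {y. c < w \<bullet> G i y}) \<inter> (\<Inter>i\<in>-A. {y. F i y \<noteq> f y})"
      by (auto simp: V_def)
    moreover have "open {y. c < w \<bullet> G i y}" for i
      using G by (intro open_Collect_less continuous_intros) auto
    moreover have "open {y. F i y \<noteq> f y}" for i
      using contF f by (intro open_Collect_neq) auto
    ultimately show ?thesis by (auto intro!: open_Int open_INT)
  qed
  moreover have "x \<in> V" using w by (auto simp: V_def A_def)
  ultimately obtain e where e: "e > 0" "ball x e \<subseteq> V"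
    using open_contains_ball by blast
  define v where "v = - w"
  have key: "(f (y + t *\<^sub>R v) - f y) / t \<le> - c" if t: "t > 0" and sub: "\<And>s. s \<in> {0..t} \<Longrightarrow> y + s *\<^sub>R v \<in> V" for y t
  proof -
    \<comment> \<open>Adding c * s turns descent at rate at least c into monotonicity of every piece
      along the segment.\<close>
    have "f (y + t *\<^sub>R v) + c * t \<le> f (y + 0 *\<^sub>R v) + c * 0"
    proof (rule continuous_selection_of_antimono[of A 0 t "\<lambda>s. f (y + s *\<^sub>R v) + c * s" "\<lambda>i s. F i (y + s *\<^sub>R v) + c * s"])
      show "continuous_on {0..t} (\<lambda>s. f (y + s *\<^sub>R v) + c * s)"
        by (intro continuous_intros continuous_on_compose2[OF f(1)]) auto
      show "continuous_on {0..t} (\<lambda>s. F i (y + s *\<^sub>R v) + c * s)" for i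
        by (intro continuous_intros continuous_on_compose2[OF contF]) auto
      show "\<exists>i\<in>A. f (y + s *\<^sub>R v) + c * s = F i (y + s *\<^sub>R v) + c * s" if "s \<in> {0..t}" for s
      proof -
        obtain i where "f (y + s *\<^sub>R v) = F i (y + s *\<^sub>R v)" using f(2) by blast
        with sub[OF that] show ?thesis by (auto simp: V_def)
      qed
      fix i s s' assume i: "i \<in> A" and s: "0 \<le> s" "s \<le> s'" "s' \<le> t"
      show "F i (y + s' *\<^sub>R v) + c * s' \<le> F i (y + s *\<^sub>R v) + c * s"
      proof (rule DERIV_nonpos_imp_nonincreasing[OF s(2)])
        fix q assume q: "s \<le> q" "q \<le> s'"
        have "((\<lambda>s. F i (y + s *\<^sub>R v) + c * s) has_derivative (\<lambda>h. G i (y + q *\<^sub>R v) \<bullet> (h *\<^sub>R v) + c * h)) (at q)"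
          by (rule derivative_eq_intros has_derivative_compose[OF _ F] refl | simp)+
        then have "((\<lambda>s. F i (y + s *\<^sub>R v) + c * s) has_real_derivative (G i (y + q *\<^sub>R v) \<bullet> v + c)) (at q)"
          by (rule has_derivative_imp_has_field_derivative) (simp add: algebra_simps)
        moreover have "w \<bullet> G i (y + q *\<^sub>R v) > c"
          using sub[of q] q s i by (auto simp: V_def)
        then have "G i (y + q *\<^sub>R v) \<bullet> v + c \<le> 0"
          by (simp add: v_def inner_commute)
        ultimately show "\<exists>d. ((\<lambda>s. F i (y + s *\<^sub>R v) + c * s) has_real_derivative d) (at q) \<and> d \<le> 0"
          by blast
      qed
    qed (use t in auto)
    then show ?thesis using t by (simp add: field_simps)
  qed
  have "\<forall>\<^sub>F p in nhds x \<times>\<^sub>F at_right (0::real). (case p of (y, t) \<Rightarrow> ereal ((f (y + t *\<^sub>R v) - f y) / t)) \<le> ereal (- c)"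
  proof -
    \<comment> \<open>If y is within e / 2 of x and t < \<delta>, the segment from y to y + t v
      stays in the ball; the summand 1 keeps the denominator positive.\<close>
    define \<delta> where "\<delta> = e / (2 * (norm v + 1))"
    have \<delta>: "\<delta> > 0" "\<delta> * norm v < e / 2"
    proof -
      have pos: "norm v + 1 > 0" by (smt (verit) norm_ge_zero)
      then show "\<delta> > 0" using e by (simp add: \<delta>_def)
      have "\<delta> * (norm v + 1) = e / 2" using pos by (simp add: \<delta>_def field_simps)
      then show "\<delta> * norm v < e / 2" using \<open>\<delta> > 0\<close> by (simp add: distrib_left)
    qed
    have "\<forall>\<^sub>F y in nhds x. dist y x < e / 2"
      using e by (intro eventually_nhds_metric[THEN iffD2]) (auto intro: exI[of _ "e/2"])
    moreover have "\<forall>\<^sub>F t in at_right (0::real). t \<in> {0<..<\<delta>}"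
      using \<delta> by (intro eventually_at_rightI[of 0 \<delta>]) auto
    ultimately have "\<forall>\<^sub>F (y, t) in nhds x \<times>\<^sub>F at_right (0::real). dist y x < e / 2 \<and> t \<in> {0<..<\<delta>}"
      by (auto simp: eventually_prod_filter)
    then show ?thesis
    proof (rule eventually_mono, clarify)
      fix y and t :: real assume y: "dist y x < e / 2" and t: "t \<in> {0<..<\<delta>}"
      have "y + s *\<^sub>R v \<in> V" if "s \<in> {0..t}" for s
      proof -
        have "norm (s *\<^sub>R v) \<le> \<delta> * norm v"
          using that t by (auto intro!: mult_right_mono)
        then have "dist (y + s *\<^sub>R v) x < e"
          using y \<delta>(2) norm_triangle_ineq[of "y - x" "s *\<^sub>R v"] by (simp add: dist_norm algebra_simps)
        then show ?thesis using e(2) by (auto simp: dist_commute)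
      qed
      then show "ereal ((f (y + t *\<^sub>R v) - f y) / t) \<le> ereal (- c)"
        using key t by auto
    qed
  qed
  then have "clarke_derivative f x v \<le> ereal (- c)"
    unfolding clarke_derivative_def by (rule Limsup_bounded)
  moreover have "0 \<le> clarke_derivative f x v"
    using crit unfolding critical_point_def clarke_subdifferential_def by (auto simp: zero_ereal_def)
  ultimately show False using w(1) by (metis ereal_less_eq(3) neg_0_le_iff_le not_le order_trans zero_ereal_def)
qed

section \<open>Monomials and their partial derivatives\<close>

definition mon :: "('n::finite \<Rightarrow> nat) \<Rightarrow> real ^ 'n \<Rightarrow> real" where
  "mon a x = (\<Prod>j\<in>UNIV. x $ j ^ a j)"

text \<open>Truncated subtraction in the exponent is harmless: for a j = 0 the factor
  \<open>real (a j)\<close> is 0.\<close>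

definition dmon :: "'n::finite \<Rightarrow> ('n \<Rightarrow> nat) \<Rightarrow> real ^ 'n \<Rightarrow> real" where
  "dmon j a x = real (a j) * x $ j ^ (a j - 1) * (\<Prod>k\<in>UNIV - {j}. x $ k ^ a k)"

text \<open>Multiplication of a monomial by the variable X_k. With exponents built from
  \<open>inc\<close>, the rewrite rules below evaluate all monomials of low degree and their
  derivatives.\<close>

definition inc :: "'n \<Rightarrow> ('n \<Rightarrow> nat) \<Rightarrow> 'n \<Rightarrow> nat" where
  "inc k a = a(k := Suc (a k))"

lemma mon_0 [simp]: "mon (\<lambda>_. 0) x = 1"
  by (simp add: mon_def)

lemma dmon_0 [simp]: "dmon j (\<lambda>_. 0) x = 0"
  by (simp add: dmon_def)

lemma mon_split: "mon a x = x $ j ^ a j * (\<Prod>k\<in>UNIV - {j}. x $ k ^ a k)"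
  unfolding mon_def by (rule prod.remove) auto

lemma mon_inc [simp]: "mon (inc k a) x = x $ k * mon a x"
proof -
  have "(\<Prod>i\<in>UNIV - {k}. x $ i ^ inc k a i) = (\<Prod>i\<in>UNIV - {k}. x $ i ^ a i)"
    by (intro prod.cong) (auto simp: inc_def)
  then show ?thesis
    by (simp add: mon_split[of _ x k]) (simp add: inc_def)
qed

lemma dmon_inc [simp]:
  "dmon j (inc k a) x = (if j = k then mon a x else 0) + x $ k * dmon j a x"
proof (cases "j = k")
  case True
  have "(\<Prod>i\<in>UNIV - {k}. x $ i ^ inc k a i) = (\<Prod>i\<in>UNIV - {k}. x $ i ^ a i)"
    by (intro prod.cong) (auto simp: inc_def)
  with True show ?thesis
    by (cases "a k") (simp_all add: dmon_def mon_split[of a x k] inc_def algebra_simps)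
next
  case False
  have k: "(\<Prod>i\<in>UNIV - {j}. x $ i ^ b i) = x $ k ^ b k * (\<Prod>i\<in>UNIV - {j} - {k}. x $ i ^ b i)" for b
    using False by (intro prod.remove) auto
  have "(\<Prod>i\<in>UNIV - {j} - {k}. x $ i ^ inc k a i) = (\<Prod>i\<in>UNIV - {j} - {k}. x $ i ^ a i)"
    by (intro prod.cong) (auto simp: inc_def)
  then show ?thesis
    using False by (simp add: dmon_def k) (simp add: inc_def)
qed

lemma sum_inc [simp]: "sum (inc k a) UNIV = Suc (sum a UNIV)" for k :: "'n::finite"
proof -
  have "sum (inc k a) UNIV = inc k a k + sum (inc k a) (UNIV - {k})"
    by (rule sum.remove) auto
  also have "sum (inc k a) (UNIV - {k}) = sum a (UNIV - {k})"
    by (intro sum.cong) (auto simp: inc_def)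
  also have "inc k a k + sum a (UNIV - {k}) = Suc (sum a UNIV)"
    by (simp add: inc_def sum.remove[of UNIV k a])
  finally show ?thesis .
qed

lemma inc_cases:
  fixes a :: "'n::finite \<Rightarrow> nat"
  obtains "a = (\<lambda>_. 0)" | k b where "a = inc k b"
proof (cases "a = (\<lambda>_. 0)")
  case False
  then obtain k where "a k > 0" by (auto simp: fun_eq_iff)
  then have "a = inc k (a(k := a k - 1))" by (auto simp: inc_def)
  then show ?thesis using that by blast
qed (use that in auto)

lemma degree_le_1_cases:
  fixes a :: "'n::finite \<Rightarrow> nat"
  assumes "sum a UNIV \<le> 1"
  obtains "a = (\<lambda>_. 0)" | j where "a = inc j (\<lambda>_. 0)"
proof (cases a rule: inc_cases)
  case (2 k b)
  then show ?thesis using assms that by (cases b rule: inc_cases) auto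
qed (use that in auto)

lemma degree_le_2_cases:
  fixes a :: "'n::finite \<Rightarrow> nat"
  assumes "sum a UNIV \<le> 2"
  obtains "a = (\<lambda>_. 0)" | j where "a = inc j (\<lambda>_. 0)" | j k where "a = inc j (inc k (\<lambda>_. 0))"
proof (cases a rule: inc_cases)
  case (2 j b)
  then have "sum b UNIV \<le> 1" using assms by simp
  then show ?thesis
    by (cases b rule: degree_le_1_cases) (use 2 that in auto)
qed (use that in auto)

lemma inc_inject [simp]: "inc j (\<lambda>_. 0) = inc k (\<lambda>_. 0) \<longleftrightarrow> j = k"
  by (auto simp: inc_def fun_eq_iff split: if_splits)

lemma inc_inc_inject [simp]: "inc j (inc e (\<lambda>_. 0)) = inc k (inc e (\<lambda>_. 0)) \<longleftrightarrow> j = k"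
  by (auto simp: inc_def fun_eq_iff split: if_splits)

lemma mon_has_derivative: "(mon a has_derivative (\<lambda>h. \<Sum>j\<in>UNIV. h $ j * dmon j a x)) (at x)"
proof -
  have "((\<lambda>x. \<Prod>j\<in>UNIV. x $ j ^ a j) has_derivative
     (\<lambda>h. \<Sum>j\<in>UNIV. of_nat (a j) * h $ j * x $ j ^ (a j - 1) * (\<Prod>k\<in>UNIV - {j}. x $ k ^ a k))) (at x)"
    by (intro has_derivative_prod has_derivative_power bounded_linear_imp_has_derivative
        bounded_linear_vec_nth)
  then show ?thesis
    by (simp add: mon_def[abs_def] dmon_def mult_ac)
qed

lemma continuous_on_dmon: "continuous_on UNIV (dmon j a)"
  unfolding dmon_def by (intro continuous_intros)

text \<open>The partial derivative in direction j, as a linear functional of the coefficients c, for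
  which the equations will be solved.\<close>

definition pd :: "'n::finite \<Rightarrow> real ^ 'n \<Rightarrow> real ^ ('n, 'd::finite) multi_index \<Rightarrow> real" where
  "pd j x c = (\<Sum>\<alpha>\<in>UNIV. c $ \<alpha> * dmon j (exponent \<alpha>) x)"

lemma poly_of_coeffs_mon: "poly_of_coeffs x c = (\<Sum>\<alpha>\<in>UNIV. c $ \<alpha> * mon (exponent \<alpha>) x)"
  by (simp add: poly_of_coeffs_def mon_def)

lemma poly_has_derivative:
  "((\<lambda>x. poly_of_coeffs x c) has_derivative (\<lambda>h. (\<chi> j. pd j x c) \<bullet> h)) (at x)"
proof -
  have "((\<lambda>x. \<Sum>\<alpha>\<in>UNIV. c $ \<alpha> * mon (exponent \<alpha>) x) has_derivative
      (\<lambda>h. \<Sum>\<alpha>\<in>UNIV. c $ \<alpha> * (\<Sum>j\<in>UNIV. h $ j * dmon j (exponent \<alpha>) x))) (at x)"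
    by (intro has_derivative_sum has_derivative_mult_right mon_has_derivative)
  moreover have "(\<Sum>\<alpha>\<in>UNIV. c $ \<alpha> * (\<Sum>j\<in>UNIV. h $ j * dmon j (exponent \<alpha>) x)) = (\<chi> j. pd j x c) \<bullet> h" for h
    unfolding inner_vec_def pd_def sum_distrib_left inner_real_def vec_lambda_beta sum_distrib_right
    by (subst sum.swap) (simp add: mult_ac)
  ultimately show ?thesis
    by (simp add: poly_of_coeffs_mon)
qed

lemma continuous_on_gradient: "continuous_on UNIV (\<lambda>x. \<chi> j. pd j x c)"
  unfolding pd_def
  by (intro continuous_on_vec_lambda continuous_on_sum continuous_on_mult continuous_on_const
      continuous_on_dmon)

text \<open>\<open>I\<close> contains the pieces with nonzero weight, hence only active ones. Any of
  the multipliers can then be scaled to 1, and the gradient equation can be solved for the slopes of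
  that piece.\<close>

definition crit_data :: "real ^ ('n::finite, 'd::finite) multi_index ^ 'r::finite \<Rightarrow> real ^ 'n \<Rightarrow>
    real \<Rightarrow> 'r set \<Rightarrow> ('r \<Rightarrow> real) \<Rightarrow> bool" where
  "crit_data u x t I l \<longleftrightarrow> I \<noteq> {} \<and> (\<forall>i\<in>I. l i \<noteq> 0 \<and> poly_of_coeffs x (u $ i) = t) \<and>
     (\<forall>j. (\<Sum>i\<in>I. l i * pd j x (u $ i)) = 0)"

lemma critical_selection_crit_data:
  assumes f: "f \<in> continuous_selections (\<lambda>x. poly_map x u)" and crit: "critical_point f x"
  shows "\<exists>I l. crit_data u x (f x) I l"
proof -
  define G where "G = (\<lambda>i. \<chi> j. pd j x (u $ i))"
  define A where "A = {i. poly_of_coeffs x (u $ i) = f x}"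
  have "0 \<in> convex hull (G ` A)"
    unfolding G_def A_def
    by (rule clarke_critical_imp_convex_combination[of f "\<lambda>i x. poly_of_coeffs x (u $ i)"
          "\<lambda>i x. \<chi> j. pd j x (u $ i)"])
      (use f crit in \<open>auto simp: continuous_selections_def poly_map_def
          intro: poly_has_derivative continuous_on_gradient\<close>)
  then obtain w where w: "sum w (G ` A) = 1" "(\<Sum>z\<in>G ` A. w z *\<^sub>R z) = 0"
    by (auto simp: convex_hull_finite)
  define B where "B = {z \<in> G ` A. w z \<noteq> 0}"
  \<comment> \<open>The weights belong to gradients, and several pieces may share a gradient. One
    piece is selected per gradient, so that no weight is counted twice.\<close>
  define g where "g = inv_into A G"
  define l where "l = (\<lambda>i. w (G i))"
  have g: "g z \<in> A" "G (g z) = z" if "z \<in> B" for z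
    using that by (auto simp: B_def g_def inv_into_into f_inv_into_f)
  have inj: "inj_on g B" by (metis g(2) inj_onI)
  have "(\<Sum>z\<in>B. w z *\<^sub>R z) = 0"
    unfolding w(2)[symmetric] by (rule sum.mono_neutral_left) (auto simp: B_def)
  moreover have "(\<Sum>i\<in>g ` B. l i *\<^sub>R G i) = (\<Sum>z\<in>B. w z *\<^sub>R z)"
    by (simp add: sum.reindex[OF inj] l_def g(2) cong: sum.cong)
  ultimately have 0: "(\<Sum>i\<in>g ` B. l i *\<^sub>R G i) = 0" by simp
  have "(\<Sum>i\<in>g ` B. l i * pd j x (u $ i)) = (\<Sum>i\<in>g ` B. l i *\<^sub>R G i) $ j" for j
    by (simp add: G_def)
  then have "(\<Sum>i\<in>g ` B. l i * pd j x (u $ i)) = 0" for j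
    by (simp add: 0)
  moreover have "B \<noteq> {}"
  proof
    assume "B = {}"
    then have "\<forall>z\<in>G ` A. w z = 0" by (auto simp: B_def)
    with w(1) show False by simp
  qed
  moreover have "l i \<noteq> 0 \<and> poly_of_coeffs x (u $ i) = f x" if "i \<in> g ` B" for i
    using that g by (auto simp: l_def A_def B_def)
  ultimately have "crit_data u x (f x) (g ` B) l"
    unfolding crit_data_def by blast
  then show ?thesis by blast
qed

lemma crit_data_normalize:
  assumes "crit_data u x t I l" "i0 \<in> I"
  shows "crit_data u x t I (\<lambda>i. l i / l i0)"
proof -
  have "(\<Sum>i\<in>I. l i / l i0 * pd j x (u $ i)) = (\<Sum>i\<in>I. l i * pd j x (u $ i)) / l i0" for j
    by (simp add: sum_divide_distrib)
  then show ?thesis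
    using assms by (auto simp: crit_data_def)
qed

section \<open>Hermite interpolation at two points\<close>

text \<open>Coefficients beyond the degree bound are 0, so the interpolation formulas for \<open>d \<ge> 3\<close> also
  make sense for \<open>d \<le> 2\<close>.\<close>

definition coef :: "real ^ ('n::finite, 'd::finite) multi_index \<Rightarrow> ('n \<Rightarrow> nat) \<Rightarrow> real" where
  "coef c a = (if sum a UNIV \<le> CARD('d) then c $ Multi_Index a else 0)"

lemma range_exponent:
  "range (exponent :: ('n::finite, 'd::finite) multi_index \<Rightarrow> _) = {a. sum a UNIV \<le> CARD('d)}"
  by (rule type_definition.Rep_range[OF type_definition_multi_index])

lemma coef_exponent [simp]: "coef c (exponent \<alpha>) = c $ \<alpha>"
  using exponent[of \<alpha>] by (simp add: coef_def exponent_inverse)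

text \<open>Isolates the unknown coefficients in a value or a slope by subtracting the known terms.
  Exponents in \<open>E\<close> beyond the degree bound contribute 0.\<close>

lemma ratfun_known_part:
  fixes c :: "'s \<Rightarrow> real ^ ('n::finite, 'd::finite) multi_index"
  assumes "finite E" "(\<lambda>s. \<Sum>\<alpha>\<in>UNIV. c s $ \<alpha> * g (exponent \<alpha>) s) \<in> ratfun S Z"
    and "\<And>a. a \<notin> E \<Longrightarrow> (\<lambda>s. coef (c s) a * g a s) \<in> ratfun S Z"
  shows "(\<lambda>s. \<Sum>a\<in>E. coef (c s) a * g a s) \<in> ratfun S Z"
proof -
  define R where "R = range (exponent :: ('n, 'd) multi_index \<Rightarrow> _)"
  have inj: "inj (exponent :: ('n, 'd) multi_index \<Rightarrow> _)"
    by (simp add: inj_on_def exponent_inject)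
  have fin: "finite R" by (simp add: R_def)
  have "(\<Sum>\<alpha>\<in>UNIV. c s $ \<alpha> * g (exponent \<alpha>) s) = (\<Sum>a\<in>R. coef (c s) a * g a s)" for s
    by (simp add: R_def sum.reindex[OF inj])
  moreover have "(\<Sum>a\<in>E. coef (c s) a * g a s) = (\<Sum>a\<in>E \<inter> R. coef (c s) a * g a s)" for s
    by (rule sum.mono_neutral_right) (use assms(1) in \<open>auto simp: R_def range_exponent coef_def\<close>)
  moreover have "(\<Sum>a\<in>R. coef (c s) a * g a s)
      = (\<Sum>a\<in>E \<inter> R. coef (c s) a * g a s) + (\<Sum>a\<in>R - E. coef (c s) a * g a s)" for s
    using sum.Int_Diff[OF fin, of _ E] by (simp add: Int_commute)
  ultimately have "(\<lambda>s. \<Sum>a\<in>E. coef (c s) a * g a s)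
      = (\<lambda>s. (\<Sum>\<alpha>\<in>UNIV. c s $ \<alpha> * g (exponent \<alpha>) s) - (\<Sum>a\<in>R - E. coef (c s) a * g a s))"
    by simp
  also have "\<dots> \<in> ratfun S Z"
    by (intro ratfun_diff ratfun_sum assms) auto
  finally show ?thesis .
qed

lemma ratfun_cancel:
  assumes "(\<lambda>s. f s * g s) \<in> ratfun S Z" "g \<in> ratfun S Z" "\<forall>s\<in>S. g s \<noteq> 0"
  shows "f \<in> ratfun S Z"
  by (rule ratfun.cong[OF ratfun_divide[OF assms]]) (use assms(3) in auto)

lemma ratfun_mon: "(\<And>j. (\<lambda>s. x s $ j) \<in> ratfun S Z) \<Longrightarrow> (\<lambda>s. mon a (x s)) \<in> ratfun S Z"
  unfolding mon_def by (intro ratfun_prod ratfun_power)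

lemma ratfun_dmon: "(\<And>j. (\<lambda>s. x s $ j) \<in> ratfun S Z) \<Longrightarrow> (\<lambda>s. dmon j a (x s)) \<in> ratfun S Z"
  unfolding dmon_def by (intro ratfun_intros)

text \<open>The exponents of \<open>1\<close>, \<open>X\<^sub>j\<close>, \<open>X\<^sub>j X\<^sub>e\<close> and \<open>X\<^sub>e ^ 3\<close>, whose coefficients are determined by the values
  and slopes at two points differing in coordinate \<open>e\<close>.\<close>

definition hermite_exponents :: "'n \<Rightarrow> ('n \<Rightarrow> nat) set" where
  "hermite_exponents e = {\<lambda>_. 0, inc e (inc e (inc e (\<lambda>_. 0)))} \<union> range (\<lambda>j. inc j (\<lambda>_. 0)) \<union>
     range (\<lambda>j. inc j (inc e (\<lambda>_. 0)))"

context
  fixes S :: "'s set" and Z :: "('s \<Rightarrow> real) set" and x y :: "'s \<Rightarrow> real ^ 'n::finite"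
    and c :: "'s \<Rightarrow> real ^ ('n, 'd::finite) multi_index" and e :: 'n
  assumes x: "\<And>j. (\<lambda>s. x s $ j) \<in> ratfun S Z" and y: "\<And>j. (\<lambda>s. y s $ j) \<in> ratfun S Z"
    and xy: "\<forall>s\<in>S. x s $ e - y s $ e \<noteq> 0"
    and free: "\<And>a. a \<notin> hermite_exponents e \<Longrightarrow> (\<lambda>s. coef (c s) a) \<in> ratfun S Z"
begin

text \<open>Among the monomials of \<open>hermite_exponents e\<close> only X_j and X_j X_e have a
  nonzero derivative in a direction j \<noteq> e.\<close>

lemma hermite_transversal_sum:
  assumes j: "j \<noteq> e" and w: "\<And>j. (\<lambda>s. w s $ j) \<in> ratfun S Z"
    and p: "(\<lambda>s. pd j (w s) (c s)) \<in> ratfun S Z"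
  shows "(\<lambda>s. coef (c s) (inc j (\<lambda>_. 0)) + coef (c s) (inc j (inc e (\<lambda>_. 0))) * w s $ e) \<in> ratfun S Z"
proof -
  have "(\<lambda>s. \<Sum>a\<in>{inc j (\<lambda>_. 0), inc j (inc e (\<lambda>_. 0))}. coef (c s) a * dmon j a (w s)) \<in> ratfun S Z"
  proof (rule ratfun_known_part)
    show "(\<lambda>s. \<Sum>\<alpha>\<in>UNIV. c s $ \<alpha> * dmon j (exponent \<alpha>) (w s)) \<in> ratfun S Z"
      using p by (simp add: pd_def)
    fix a assume a: "a \<notin> {inc j (\<lambda>_. 0), inc j (inc e (\<lambda>_. 0))}"
    show "(\<lambda>s. coef (c s) a * dmon j a (w s)) \<in> ratfun S Z"
    proof (cases "a \<in> hermite_exponents e")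
      case True
      then have "dmon j a v = 0" for v
        using a j by (auto simp: hermite_exponents_def)
      then show ?thesis by (simp add: ratfun.const)
    next
      case False
      then show ?thesis by (intro ratfun.mult free ratfun_dmon w)
    qed
  qed simp
  moreover have "inc j (\<lambda>_. 0) \<noteq> inc j (inc e (\<lambda>_. 0))"
    by (auto dest: arg_cong[of _ _ "\<lambda>a. sum a UNIV"])
  ultimately show ?thesis
    using j by simp
qed

text \<open>The two points give two linear equations for two coefficients, with determinant x_e -
  y_e up to sign.\<close>

lemma hermite_transversal:
  assumes j: "j \<noteq> e"
    and p: "(\<lambda>s. pd j (x s) (c s)) \<in> ratfun S Z" "(\<lambda>s. pd j (y s) (c s)) \<in> ratfun S Z"
  shows "(\<lambda>s. coef (c s) (inc j (\<lambda>_. 0))) \<in> ratfun S Z"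
    "(\<lambda>s. coef (c s) (inc j (inc e (\<lambda>_. 0)))) \<in> ratfun S Z"
proof -
  note sums = hermite_transversal_sum[OF j x p(1)] hermite_transversal_sum[OF j y p(2)]
  have "(\<lambda>s. coef (c s) (inc j (inc e (\<lambda>_. 0))) * (x s $ e - y s $ e)) \<in> ratfun S Z"
    using ratfun_diff[OF sums] by (simp add: algebra_simps)
  then show 2: "(\<lambda>s. coef (c s) (inc j (inc e (\<lambda>_. 0)))) \<in> ratfun S Z"
    by (rule ratfun_cancel) (use xy in \<open>auto intro!: ratfun_diff x y\<close>)
  show "(\<lambda>s. coef (c s) (inc j (\<lambda>_. 0))) \<in> ratfun S Z"
    using ratfun_diff[OF sums(1) ratfun.mult[OF 2 x[of e]]] by simp
qed

section \<open>One-variable interpolation along the axis e\<close>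

abbreviation (input) "axis_exponents \<equiv>
  {\<lambda>_. 0, inc e (\<lambda>_. 0), inc e (inc e (\<lambda>_. 0)), inc e (inc e (inc e (\<lambda>_. 0)))}"

context
  assumes transversal: "\<And>j. j \<noteq> e \<Longrightarrow> (\<lambda>s. coef (c s) (inc j (\<lambda>_. 0))) \<in> ratfun S Z"
    "\<And>j. j \<noteq> e \<Longrightarrow> (\<lambda>s. coef (c s) (inc j (inc e (\<lambda>_. 0)))) \<in> ratfun S Z"
begin

abbreviation (input) "c0 s \<equiv> coef (c s) (\<lambda>_. 0)"
abbreviation (input) "c1 s \<equiv> coef (c s) (inc e (\<lambda>_. 0))"
abbreviation (input) "c2 s \<equiv> coef (c s) (inc e (inc e (\<lambda>_. 0)))"
abbreviation (input) "c3 s \<equiv> coef (c s) (inc e (inc e (inc e (\<lambda>_. 0))))"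

lemma hermite_off_axis:
  assumes "a \<notin> axis_exponents"
  shows "(\<lambda>s. coef (c s) a) \<in> ratfun S Z"
proof (cases "a \<in> hermite_exponents e")
  case True
  then consider j where "j \<noteq> e" "a = inc j (\<lambda>_. 0)" | j where "j \<noteq> e" "a = inc j (inc e (\<lambda>_. 0))"
    using assms by (auto simp: hermite_exponents_def)
  then show ?thesis using transversal by cases auto
qed (rule free)

lemma axis_exponents_distinct:
  "(\<lambda>_. 0) \<notin> {inc e (\<lambda>_. 0), inc e (inc e (\<lambda>_. 0)), inc e (inc e (inc e (\<lambda>_. 0)))}"
  "inc e (\<lambda>_. 0) \<notin> {inc e (inc e (\<lambda>_. 0)), inc e (inc e (inc e (\<lambda>_. 0)))}"
  "inc e (inc e (\<lambda>_. 0)) \<notin> {inc e (inc e (inc e (\<lambda>_. 0)))}"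
  by (auto dest: arg_cong[of _ _ "\<lambda>a. sum a UNIV"])

lemma hermite_axis_value:
  assumes w: "\<And>j. (\<lambda>s. w s $ j) \<in> ratfun S Z"
    and v: "(\<lambda>s. poly_of_coeffs (w s) (c s)) \<in> ratfun S Z"
  shows "(\<lambda>s. c0 s + c1 s * w s $ e + c2 s * w s $ e ^ 2 + c3 s * w s $ e ^ 3) \<in> ratfun S Z"
proof -
  have "(\<lambda>s. \<Sum>a\<in>axis_exponents. coef (c s) a * mon a (w s)) \<in> ratfun S Z"
  proof (rule ratfun_known_part)
    show "(\<lambda>s. \<Sum>\<alpha>\<in>UNIV. c s $ \<alpha> * mon (exponent \<alpha>) (w s)) \<in> ratfun S Z"
      using v by (simp add: poly_of_coeffs_mon)
  qed (auto intro!: ratfun.mult hermite_off_axis ratfun_mon w)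
  then show ?thesis
    using axis_exponents_distinct by (simp add: power2_eq_square power3_eq_cube algebra_simps)
qed

lemma hermite_axis_slope:
  assumes w: "\<And>j. (\<lambda>s. w s $ j) \<in> ratfun S Z"
    and p: "(\<lambda>s. pd e (w s) (c s)) \<in> ratfun S Z"
  shows "(\<lambda>s. c1 s + 2 * c2 s * w s $ e + 3 * c3 s * w s $ e ^ 2) \<in> ratfun S Z"
proof -
  have "(\<lambda>s. \<Sum>a\<in>axis_exponents. coef (c s) a * dmon e a (w s)) \<in> ratfun S Z"
  proof (rule ratfun_known_part)
    show "(\<lambda>s. \<Sum>\<alpha>\<in>UNIV. c s $ \<alpha> * dmon e (exponent \<alpha>) (w s)) \<in> ratfun S Z"
      using p by (simp add: pd_def)
  qed (auto intro!: ratfun.mult hermite_off_axis ratfun_dmon w)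
  then show ?thesis
    using axis_exponents_distinct by (simp add: power2_eq_square algebra_simps)
qed

context
  assumes vx: "(\<lambda>s. poly_of_coeffs (x s) (c s)) \<in> ratfun S Z"
    and vy: "(\<lambda>s. poly_of_coeffs (y s) (c s)) \<in> ratfun S Z"
begin

text \<open>The two values determine the affine part c0 + c1 X_e, again dividing by x_e -
  y_e.\<close>

lemma hermite_linear:
  assumes c2: "c2 \<in> ratfun S Z" and c3: "c3 \<in> ratfun S Z"
  shows "(\<lambda>s. coef (c s) a) \<in> ratfun S Z"
proof -
  note v = hermite_axis_value[OF x vx] hermite_axis_value[OF y vy]
  have v': "(\<lambda>s. c0 s + c1 s * w s $ e) \<in> ratfun S Z"
    if "(\<lambda>s. c0 s + c1 s * w s $ e + c2 s * w s $ e ^ 2 + c3 s * w s $ e ^ 3) \<in> ratfun S Z"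
      "(\<lambda>s. w s $ e) \<in> ratfun S Z" for w :: "'s \<Rightarrow> real ^ 'n"
  proof -
    have "(\<lambda>s. c2 s * w s $ e ^ 2 + c3 s * w s $ e ^ 3) \<in> ratfun S Z"
      by (intro ratfun_intros that c2 c3)
    from ratfun_diff[OF that(1) this] show ?thesis by simp
  qed
  have "(\<lambda>s. c1 s * (x s $ e - y s $ e)) \<in> ratfun S Z"
    using ratfun_diff[OF v'[OF v(1) x] v'[OF v(2) y]] by (simp add: algebra_simps)
  then have c1: "c1 \<in> ratfun S Z"
    by (rule ratfun_cancel) (use xy in \<open>auto intro!: ratfun_diff x y\<close>)
  have "c0 \<in> ratfun S Z"
    using ratfun_diff[OF v'[OF v(1) x] ratfun.mult[OF c1 x[of e]]] by simp
  with c1 c2 c3 show ?thesis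
    by (cases "a \<in> axis_exponents") (auto intro: hermite_off_axis)
qed

context
  assumes px: "(\<lambda>s. pd e (x s) (c s)) \<in> ratfun S Z"
begin

text \<open>With p the polynomial along the axis, the Taylor remainder p(x) - p(y) - p'(x)(x - y)
  equals -c2 (x - y)^2 once the contribution of c3 is removed.\<close>

lemma hermite_quadratic:
  assumes c3: "c3 \<in> ratfun S Z"
  shows "(\<lambda>s. coef (c s) a) \<in> ratfun S Z"
proof (rule hermite_linear[OF _ c3])
  have "(\<lambda>s. (c0 s + c1 s * x s $ e + c2 s * x s $ e ^ 2 + c3 s * x s $ e ^ 3)
      - (c0 s + c1 s * y s $ e + c2 s * y s $ e ^ 2 + c3 s * y s $ e ^ 3)
      - (c1 s + 2 * c2 s * x s $ e + 3 * c3 s * x s $ e ^ 2) * (x s $ e - y s $ e)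
      - c3 s * (x s $ e ^ 3 - y s $ e ^ 3 - 3 * x s $ e ^ 2 * (x s $ e - y s $ e))) \<in> ratfun S Z"
    by (intro ratfun_diff hermite_axis_value vx vy hermite_axis_slope px ratfun.mult c3 ratfun_intros x y)
  also have "(\<lambda>s. (c0 s + c1 s * x s $ e + c2 s * x s $ e ^ 2 + c3 s * x s $ e ^ 3)
      - (c0 s + c1 s * y s $ e + c2 s * y s $ e ^ 2 + c3 s * y s $ e ^ 3)
      - (c1 s + 2 * c2 s * x s $ e + 3 * c3 s * x s $ e ^ 2) * (x s $ e - y s $ e)
      - c3 s * (x s $ e ^ 3 - y s $ e ^ 3 - 3 * x s $ e ^ 2 * (x s $ e - y s $ e)))
      = (\<lambda>s. c2 s * - ((x s $ e - y s $ e) ^ 2))"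
    by (simp add: fun_eq_iff power2_eq_square power3_eq_cube algebra_simps)
  finally show "c2 \<in> ratfun S Z"
    by (rule ratfun_cancel) (use xy in \<open>auto intro!: ratfun_intros x y\<close>)
qed

text \<open>The error of the trapezoidal rule, (p'(x) + p'(y))(x - y) - 2 (p(x) - p(y)) = c3 (x -
  y)^3, vanishes on quadratics and so isolates the cubic coefficient.\<close>

lemma hermite_cubic:
  assumes py: "(\<lambda>s. pd e (y s) (c s)) \<in> ratfun S Z"
  shows "(\<lambda>s. coef (c s) a) \<in> ratfun S Z"
proof (rule hermite_quadratic)
  have "(\<lambda>s. ((c1 s + 2 * c2 s * x s $ e + 3 * c3 s * x s $ e ^ 2)
        + (c1 s + 2 * c2 s * y s $ e + 3 * c3 s * y s $ e ^ 2)) * (x s $ e - y s $ e)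
      - 2 * ((c0 s + c1 s * x s $ e + c2 s * x s $ e ^ 2 + c3 s * x s $ e ^ 3)
      - (c0 s + c1 s * y s $ e + c2 s * y s $ e ^ 2 + c3 s * y s $ e ^ 3))) \<in> ratfun S Z"
    by (intro ratfun_diff ratfun.mult ratfun.add hermite_axis_value vx vy hermite_axis_slope px py ratfun.const x y)
  also have "(\<lambda>s. ((c1 s + 2 * c2 s * x s $ e + 3 * c3 s * x s $ e ^ 2)
        + (c1 s + 2 * c2 s * y s $ e + 3 * c3 s * y s $ e ^ 2)) * (x s $ e - y s $ e)
      - 2 * ((c0 s + c1 s * x s $ e + c2 s * x s $ e ^ 2 + c3 s * x s $ e ^ 3)
      - (c0 s + c1 s * y s $ e + c2 s * y s $ e ^ 2 + c3 s * y s $ e ^ 3)))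
      = (\<lambda>s. c3 s * (x s $ e - y s $ e) ^ 3)"
    by (simp add: fun_eq_iff power2_eq_square power3_eq_cube algebra_simps)
  finally show "c3 \<in> ratfun S Z"
    by (rule ratfun_cancel) (use xy in \<open>auto intro!: ratfun_intros x y\<close>)
qed

end

end

end

end

text \<open>The trapezoidal rule is exact in degree at most 2; by linearity it is checked on
  monomials.\<close>

lemma quadratic_value_difference:
  fixes c :: "real ^ ('n::finite, 'd::finite) multi_index"
  assumes "CARD('d) \<le> 2"
  shows "2 * (poly_of_coeffs x c - poly_of_coeffs y c) = (\<Sum>j\<in>UNIV. (pd j x c + pd j y c) * (x $ j - y $ j))"
proof -
  have delta: "(\<Sum>j\<in>UNIV. (if j = k then p else 0) * q j) = p * q k" for k :: 'n and p :: real and q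
    by (simp add: if_distrib[of "\<lambda>z. z * _"] cong: if_cong)
  have *: "2 * (mon a x - mon a y) = (\<Sum>j\<in>UNIV. (dmon j a x + dmon j a y) * (x $ j - y $ j))"
    if "sum a UNIV \<le> 2" for a
    using that
  proof (cases a rule: degree_le_2_cases)
    case (2 j)
    then show ?thesis by (simp add: distrib_right sum.distrib delta)
  next
    case (3 j k)
    have "(\<Sum>i\<in>UNIV. (dmon i a x + dmon i a y) * (x $ i - y $ i))
       = (\<Sum>i\<in>UNIV. (if i = j then x $ k else 0) * (x $ i - y $ i)) + (\<Sum>i\<in>UNIV. (if i = k then x $ j else 0) * (x $ i - y $ i))
        + (\<Sum>i\<in>UNIV. (if i = j then y $ k else 0) * (x $ i - y $ i)) + (\<Sum>i\<in>UNIV. (if i = k then y $ j else 0) * (x $ i - y $ i))"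
      unfolding sum.distrib[symmetric] by (intro sum.cong) (auto simp: 3 algebra_simps)
    then show ?thesis unfolding delta by (simp add: 3 algebra_simps)
  qed auto
  have deg: "sum (exponent \<alpha>) UNIV \<le> 2" for \<alpha> :: "('n, 'd) multi_index"
    using exponent[of \<alpha>] assms by simp
  have "2 * (poly_of_coeffs x c - poly_of_coeffs y c)
      = (\<Sum>\<alpha>\<in>UNIV. c $ \<alpha> * (2 * (mon (exponent \<alpha>) x - mon (exponent \<alpha>) y)))"
    by (simp add: poly_of_coeffs_mon sum_subtractf[symmetric] sum_distrib_left algebra_simps)
  also have "\<dots> = (\<Sum>\<alpha>\<in>UNIV. \<Sum>j\<in>UNIV. c $ \<alpha> * ((dmon j (exponent \<alpha>) x + dmon j (exponent \<alpha>) y) * (x $ j - y $ j)))"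
    by (simp only: *[OF deg] sum_distrib_left)
  also have "\<dots> = (\<Sum>j\<in>UNIV. \<Sum>\<alpha>\<in>UNIV. c $ \<alpha> * ((dmon j (exponent \<alpha>) x + dmon j (exponent \<alpha>) y) * (x $ j - y $ j)))"
    by (rule sum.swap)
  also have "\<dots> = (\<Sum>j\<in>UNIV. (pd j x c + pd j y c) * (x $ j - y $ j))"
    unfolding pd_def sum.distrib[symmetric] sum_distrib_right by (simp add: algebra_simps)
  finally show ?thesis .
qed

lemma quadratic_gradient_affine:
  fixes c :: "real ^ ('n::finite, 'd::finite) multi_index"
  assumes "CARD('d) \<le> 2"
  shows "pd j (x + q *\<^sub>R (y - x)) c = pd j x c + q * (pd j y c - pd j x c)"
proof -
  have *: "dmon j a (x + q *\<^sub>R (y - x)) = dmon j a x + q * (dmon j a y - dmon j a x)"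
    if "sum a UNIV \<le> 2" for a
    using that by (cases a rule: degree_le_2_cases) (auto simp: algebra_simps)
  have deg: "sum (exponent \<alpha>) UNIV \<le> 2" for \<alpha> :: "('n, 'd) multi_index"
    using exponent[of \<alpha>] assms by simp
  show ?thesis
    unfolding pd_def *[OF deg]
    by (simp add: sum_subtractf[symmetric] sum.distrib[symmetric] sum_distrib_left algebra_simps)
qed

definition free_indices :: "'n \<Rightarrow> ('n::finite, 'd::finite) multi_index set" where
  "free_indices e = {\<alpha>. exponent \<alpha> \<notin> hermite_exponents e}"

text \<open>The Hermite exponents of degree at most d number 1 + n, 1 + 2n or 2 + 2n for d = 1, d =
  2 or d \<ge> 3: as many as there are independent values and slopes to replace them. The monomial
  X_e^2 is one of the X_j X_e.\<close>

lemma card_free_indices: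
  "card (free_indices e :: ('n::finite, 'd::finite) multi_index set) + 1 + CARD('n)
     + (if CARD('d) \<ge> 2 then CARD('n) else 0) + (if CARD('d) \<ge> 3 then 1 else 0)
     \<le> CARD(('n, 'd) multi_index)"
proof -
  define H where "H = {\<alpha> :: ('n, 'd) multi_index. exponent \<alpha> \<in> hermite_exponents e}"
  have inj: "inj (exponent :: ('n, 'd) multi_index \<Rightarrow> _)"
    by (simp add: inj_on_def exponent_inject)
  have img: "exponent ` H = hermite_exponents e \<inter> {a. sum a UNIV \<le> CARD('d)}"
    unfolding H_def range_exponent[symmetric] by auto
  define E0 where "E0 = {\<lambda>_::'n. 0::nat}"
  define E1 where "E1 = range (\<lambda>j::'n. inc j (\<lambda>_. 0))"
  define E2 where "E2 = (if CARD('d) \<ge> 2 then range (\<lambda>j::'n. inc j (inc e (\<lambda>_. 0))) else {})"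
  define E3 where "E3 = (if CARD('d) \<ge> 3 then {inc e (inc e (inc e (\<lambda>_. 0)))} else {})"
  have deg: "a \<in> E0 \<Longrightarrow> sum a UNIV = 0" "a \<in> E1 \<Longrightarrow> sum a UNIV = 1" "a \<in> E2 \<Longrightarrow> sum a UNIV = 2"
    "a \<in> E3 \<Longrightarrow> sum a UNIV = 3" for a
    by (auto simp: E0_def E1_def E2_def E3_def split: if_splits)
  have fin: "finite E0" "finite E1" "finite E2" "finite E3"
    by (auto simp: E0_def E1_def E2_def E3_def)
  have "card E0 = 1" "card E1 = CARD('n)" "card E2 = (if CARD('d) \<ge> 2 then CARD('n) else 0)"
    "card E3 = (if CARD('d) \<ge> 3 then 1 else 0)"
    by (auto simp: E0_def E1_def E2_def E3_def card_image inj_on_def)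
  moreover have "card (E0 \<union> E1 \<union> E2 \<union> E3) = card E0 + card E1 + card E2 + card E3"
  proof -
    have "E0 \<inter> E1 = {}" "(E0 \<union> E1) \<inter> E2 = {}" "(E0 \<union> E1 \<union> E2) \<inter> E3 = {}"
      using deg by fastforce+
    then show ?thesis
      using fin by (simp add: card_Un_disjoint)
  qed
  moreover have "card (E0 \<union> E1 \<union> E2 \<union> E3) \<le> card (exponent ` H)"
  proof (rule card_mono)
    have "1 \<le> CARD('d)" by (simp add: Suc_leI)
    then show "E0 \<union> E1 \<union> E2 \<union> E3 \<subseteq> exponent ` H"
      unfolding img by (auto simp: E0_def E1_def E2_def E3_def hermite_exponents_def)
  qed simp
  moreover have "card (exponent ` H) = card H"
    by (intro card_image inj_on_subset[OF inj]) auto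
  moreover have "card H + card (free_indices e :: ('n, 'd) multi_index set) = CARD(('n, 'd) multi_index)"
  proof -
    have "H \<union> free_indices e = UNIV" "H \<inter> free_indices e = {}"
      by (auto simp: H_def free_indices_def)
    then show ?thesis by (metis card_Un_disjoint finite)
  qed
  ultimately show ?thesis by simp
qed

section \<open>Coincident critical values\<close>

text \<open>This is how an equation saves a generator: the quantity with index i0 is expressed
  through the others.\<close>

lemma ratfun_solve:
  fixes I :: "'r::finite set"
  assumes "i0 \<in> I" "\<And>s. s \<in> S \<Longrightarrow> (\<Sum>i\<in>I. l s i * q i s) = 0" "\<And>s. s \<in> S \<Longrightarrow> l s i0 \<noteq> 0"
    and "\<And>i. i \<in> I \<Longrightarrow> (\<lambda>s. l s i) \<in> ratfun S Z" "\<And>i. i \<in> I \<Longrightarrow> i \<noteq> i0 \<Longrightarrow> q i \<in> ratfun S Z"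
  shows "q i0 \<in> ratfun S Z"
proof (rule ratfun_cancel)
  have "(\<lambda>s. - (\<Sum>i\<in>I - {i0}. l s i * q i s)) \<in> ratfun S Z"
    using assms by (intro ratfun_minus ratfun_sum ratfun.mult) auto
  then show "(\<lambda>s. q i0 s * l s i0) \<in> ratfun S Z"
  proof (rule ratfun.cong, intro ballI)
    fix s assume "s \<in> S"
    then show "q i0 s * l s i0 = - (\<Sum>i\<in>I - {i0}. l s i * q i s)"
      using assms(2)[of s] sum.remove[of I i0 "\<lambda>i. l s i * q i s"] assms(1) by (simp add: mult.commute)
  qed
qed (use assms in auto)

lemma card_complement: "card (- A) = CARD('r) - card A" for A :: "'r::finite set"
  by (simp add: Compl_eq_Diff_UNIV card_Diff_subset)

text \<open>The dependence result for the identity map: the parameter set is the set of coefficients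
  itself, and the generators are functions of u.\<close>

lemma thin_coefficients:
  fixes S :: "(real ^ ('n::finite, 'd::finite) multi_index ^ 'r::finite) set"
  assumes "finite Z" "card Z < CARD('r) * CARD(('n, 'd) multi_index)"
    and "\<And>i a. (\<lambda>u. coef (u $ i) a) \<in> ratfun S Z"
  shows "thin S"
proof -
  have "thin ((\<lambda>u. u) ` S)"
  proof (rule thin_image_ratfun[OF assms(1)])
    fix b :: "real ^ ('n, 'd) multi_index ^ 'r" assume "b \<in> Basis"
    then obtain i \<alpha> where "b = axis i (axis \<alpha> 1)"
      by (auto simp: Basis_vec_def)
    then have "(\<lambda>u. u \<bullet> b) = (\<lambda>u. coef (u $ i) (exponent \<alpha>))"
      by (simp add: inner_axis)
    then show "(\<lambda>u. u \<bullet> b) \<in> ratfun S Z" using assms(3) by (simp only:)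
  qed (use assms(2) in simp)
  then show ?thesis by simp
qed

lemma pd_linear:
  fixes c :: "real ^ ('n::finite, 'd::finite) multi_index"
  assumes "CARD('d) = 1"
  shows "pd j x c = coef c (inc j (\<lambda>_. 0))"
proof -
  define \<beta> :: "('n, 'd) multi_index" where "\<beta> = Multi_Index (inc j (\<lambda>_. 0))"
  have \<beta>: "exponent \<beta> = inc j (\<lambda>_. 0)"
    using assms by (simp add: \<beta>_def Multi_Index_inverse)
  have "c $ \<alpha> * dmon j (exponent \<alpha>) x = (if \<alpha> = \<beta> then coef c (inc j (\<lambda>_. 0)) else 0)" for \<alpha>
  proof -
    have "sum (exponent \<alpha>) UNIV \<le> 1" using exponent[of \<alpha>] assms by simp
    then show ?thesis
    proof (cases "exponent \<alpha>" rule: degree_le_1_cases)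
      case 1
      then have "\<alpha> \<noteq> \<beta>" using \<beta> by (metis inc_def fun_upd_same nat.distinct(1))
      then show ?thesis using 1 by simp
    next
      case (2 k)
      then have "\<alpha> = \<beta> \<longleftrightarrow> k = j" using \<beta> by (metis exponent_inject inc_inject)
      then show ?thesis using 2 \<beta> coef_exponent[of c \<alpha>] by auto
    qed
  qed
  then show ?thesis by (simp add: pd_def)
qed

text \<open>One critical point is enough here: n equations between constant gradients involve only
  card I - 1 < n multipliers.\<close>

lemma thin_few_linear_forms:
  fixes S :: "(real ^ ('n::finite, 'd::finite) multi_index ^ 'r::finite) set"
  assumes d: "CARD('d) = 1" and I: "card I \<le> CARD('n)" "i0 \<in> I"
    and crit: "\<And>u. u \<in> S \<Longrightarrow> crit_data u (x u) (t u) I (l u)" "\<And>u. u \<in> S \<Longrightarrow> l u i0 = 1"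
  shows "thin S"
proof (rule thin_coefficients)
  define Z1 where "Z1 = (\<lambda>i u. l u i) ` (I - {i0})"
  define Z2 :: "((real ^ ('n, 'd) multi_index ^ 'r) \<Rightarrow> real) set"
    where "Z2 = range (\<lambda>i u. coef (u $ i) (\<lambda>_. 0))"
  define Z3 :: "((real ^ ('n, 'd) multi_index ^ 'r) \<Rightarrow> real) set"
    where "Z3 = (\<lambda>(i, j) u. coef (u $ i) (inc j (\<lambda>_. 0))) ` ((- {i0}) \<times> UNIV)"
  let ?Z = "Z1 \<union> Z2 \<union> Z3"
  show "finite ?Z" by (simp add: Z1_def Z2_def Z3_def)
  have "card Z1 \<le> card I - 1" "card Z2 \<le> CARD('r)" "card Z3 \<le> (CARD('r) - 1) * CARD('n)"
    unfolding Z1_def Z2_def Z3_def using I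
    by (auto intro!: card_image_le[THEN order_trans] simp: card_cartesian_product card_complement)
  moreover have "card ?Z \<le> card Z1 + card Z2 + card Z3"
    using card_Un_le[of "Z1 \<union> Z2" Z3] card_Un_le[of Z1 Z2] by linarith
  moreover have "CARD('r) * (1 + CARD('n)) \<le> CARD('r) * CARD(('n, 'd) multi_index)"
    using card_free_indices[of "undefined :: 'n", where ?'d='d] by (intro mult_le_mono2) (simp add: d)
  moreover obtain r where "CARD('r) = Suc r" by (metis card_gt_0_iff finite UNIV_not_empty gr0_conv_Suc)
  moreover have "card I \<ge> 1" using I(2) by (auto simp: Suc_le_eq card_gt_0_iff)
  ultimately show "card ?Z < CARD('r) * CARD(('n, 'd) multi_index)"
    using I(1) by (simp add: algebra_simps)
  have gen: "z \<in> ratfun S ?Z" if "z \<in> ?Z" for z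
    using that by (rule ratfun.generator)
  have l: "(\<lambda>u. l u i) \<in> ratfun S ?Z" if "i \<in> I" for i
  proof (cases "i = i0")
    case True
    then show ?thesis by (intro ratfun.cong[OF ratfun.const[of 1]]) (use crit in auto)
  next
    case False
    then show ?thesis by (intro gen) (use that in \<open>auto simp: Z1_def\<close>)
  qed
  have c: "(\<lambda>u. coef (u $ i) (inc j (\<lambda>_. 0))) \<in> ratfun S ?Z" if "i \<noteq> i0" for i j
  proof (rule gen)
    show "(\<lambda>u. coef (u $ i) (inc j (\<lambda>_. 0))) \<in> ?Z"
      unfolding Z3_def using that by (intro UnI2 image_eqI[of _ _ "(i, j)"]) auto
  qed
  have c': "(\<lambda>u. coef (u $ i) (inc j (\<lambda>_. 0))) \<in> ratfun S ?Z" for i j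
  proof (cases "i = i0")
    case True
    show ?thesis unfolding True
      by (rule ratfun_solve[OF I(2), of S l "\<lambda>i u. coef (u $ i) (inc j (\<lambda>_. 0))"])
        (use crit l c in \<open>auto simp: crit_data_def pd_linear[OF d]\<close>)
  qed (rule c)
  fix i and a :: "'n \<Rightarrow> nat"
  show "(\<lambda>u. coef (u $ i) a) \<in> ratfun S ?Z"
  proof (cases "sum a UNIV \<le> 1")
    case True
    have "(\<lambda>u. coef (u $ i) (\<lambda>_. 0)) \<in> ratfun S ?Z"
      by (intro gen) (auto simp: Z2_def)
    with True show ?thesis
      by (cases a rule: degree_le_1_cases) (simp_all add: c')
  next
    case False
    then show ?thesis using d by (simp add: coef_def ratfun.const)
  qed
qed

text \<open>A family of fixed combinatorial type, with one witness for each u. The coincidence to be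
  excluded is expressed by the common value t.\<close>

locale critical_pairs =
  fixes S :: "(real ^ ('n::finite, 'd::finite) multi_index ^ 'r::finite) set"
    and x y :: "real ^ ('n, 'd) multi_index ^ 'r \<Rightarrow> real ^ 'n"
    and t :: "real ^ ('n, 'd) multi_index ^ 'r \<Rightarrow> real"
    and l m :: "real ^ ('n, 'd) multi_index ^ 'r \<Rightarrow> 'r \<Rightarrow> real"
    and I J :: "'r set" and e :: 'n and i0 j0 :: 'r
  assumes separated: "\<And>u. u \<in> S \<Longrightarrow> x u $ e \<noteq> y u $ e"
    and crit_x: "\<And>u. u \<in> S \<Longrightarrow> crit_data u (x u) (t u) I (l u)"
    and crit_y: "\<And>u. u \<in> S \<Longrightarrow> crit_data u (y u) (t u) J (m u)"
    and i0: "i0 \<in> I" "\<And>u. u \<in> S \<Longrightarrow> l u i0 = 1"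
    and j0: "j0 \<in> J" "\<And>u. u \<in> S \<Longrightarrow> m u j0 = 1"
begin

abbreviation "coordinates B \<equiv> (\<lambda>j u. x u $ j) ` B \<union> (\<lambda>j u. y u $ j) ` B \<union> {t}"
abbreviation "multipliers_x \<equiv> (\<lambda>i u. l u i) ` (I - {i0})"
abbreviation "multipliers_y \<equiv> (\<lambda>i u. m u i) ` (J - {j0})"
abbreviation "values_x A \<equiv> (\<lambda>i u. poly_of_coeffs (x u) (u $ i)) ` A"
abbreviation "values_y A \<equiv> (\<lambda>i u. poly_of_coeffs (y u) (u $ i)) ` A"
abbreviation "slopes_x A \<equiv> (\<lambda>(i, j) u. pd j (x u) (u $ i)) ` A"
abbreviation "slopes_y A \<equiv> (\<lambda>(i, j) u. pd j (y u) (u $ i)) ` A"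
abbreviation "free_coefficients \<equiv>
  (\<lambda>(i, \<alpha>) u :: real ^ ('n, 'd) multi_index ^ 'r. u $ i $ \<alpha>) ` (UNIV \<times> free_indices e)"

text \<open>Upper bounds are the right form here and below, since different indices may give the
  same function.\<close>

lemma card_coordinates: "card (coordinates B) \<le> 2 * card B + 1"
  using card_Un_le[of "(\<lambda>j u. x u $ j) ` B \<union> (\<lambda>j u. y u $ j) ` B" "{t}"]
    card_Un_le[of "(\<lambda>j u. x u $ j) ` B" "(\<lambda>j u. y u $ j) ` B"]
    card_image_le[of B "\<lambda>j u. x u $ j"] card_image_le[of B "\<lambda>j u. y u $ j"]
  by simp

lemma card_multipliers: "card multipliers_x \<le> card I - 1" "card multipliers_y \<le> card J - 1"
  using i0 j0 by (auto intro!: card_image_le[THEN order_trans])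

lemma card_free_coefficients: "card free_coefficients \<le> CARD('r) * card (free_indices e :: ('n, 'd) multi_index set)"
  by (auto intro!: card_image_le[THEN order_trans] simp: card_cartesian_product)

lemma card_image_complement_le: "card (f ` (- A)) \<le> CARD('r) - card A" for A :: "'r set"
  by (auto intro!: card_image_le[THEN order_trans] simp: card_complement)

lemma card_image_times_le: "card (f ` (A \<times> B)) \<le> card A * card B" for A :: "'r set" and B :: "'n set"
  by (auto intro!: card_image_le[THEN order_trans] simp: card_cartesian_product)

lemma card_I_J: "1 \<le> card I" "card I \<le> CARD('r)" "1 \<le> card J" "card J \<le> CARD('r)"
  using i0(1) j0(1) by (auto simp: Suc_le_eq card_gt_0_iff intro!: card_mono)

context
  fixes Z assumes free_Z: "free_coefficients \<subseteq> Z"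
begin

lemma ratfun_free: "a \<notin> hermite_exponents e \<Longrightarrow> (\<lambda>u. coef (u $ i) a) \<in> ratfun S Z"
proof (cases "sum a UNIV \<le> CARD('d)")
  case True
  assume "a \<notin> hermite_exponents e"
  with True have "Multi_Index a \<in> (free_indices e :: ('n, 'd) multi_index set)"
    by (simp add: free_indices_def Multi_Index_inverse)
  then have "(\<lambda>u. u $ i $ Multi_Index a) \<in> Z"
    by (intro subsetD[OF free_Z] image_eqI[of _ _ "(i, Multi_Index a)"]) auto
  then show ?thesis using True by (simp add: coef_def ratfun.generator)
qed (simp add: coef_def ratfun.const)

text \<open>Active pieces share the generator t; each inactive piece must bring a generator of its
  own.\<close>

lemma ratfun_value_x:
  assumes "t \<in> Z" "i \<notin> I \<Longrightarrow> (\<lambda>u. poly_of_coeffs (x u) (u $ i)) \<in> ratfun S Z"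
  shows "(\<lambda>u. poly_of_coeffs (x u) (u $ i)) \<in> ratfun S Z"
proof (cases "i \<in> I")
  case True
  then show ?thesis
    by (intro ratfun.cong[OF ratfun.generator[OF assms(1)]]) (use crit_x in \<open>auto simp: crit_data_def\<close>)
qed (rule assms)

lemma ratfun_value_y:
  assumes "t \<in> Z" "i \<notin> J \<Longrightarrow> (\<lambda>u. poly_of_coeffs (y u) (u $ i)) \<in> ratfun S Z"
  shows "(\<lambda>u. poly_of_coeffs (y u) (u $ i)) \<in> ratfun S Z"
proof (cases "i \<in> J")
  case True
  then show ?thesis
    by (intro ratfun.cong[OF ratfun.generator[OF assms(1)]]) (use crit_y in \<open>auto simp: crit_data_def\<close>)
qed (rule assms)

lemma ratfun_multiplier_x:
  assumes "multipliers_x \<subseteq> Z" "i \<in> I"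
  shows "(\<lambda>u. l u i) \<in> ratfun S Z"
proof (cases "i = i0")
  case True
  then show ?thesis by (intro ratfun.cong[OF ratfun.const[of 1]]) (use i0 in auto)
qed (use assms in \<open>auto intro: ratfun.generator\<close>)

lemma ratfun_multiplier_y:
  assumes "multipliers_y \<subseteq> Z" "i \<in> J"
  shows "(\<lambda>u. m u i) \<in> ratfun S Z"
proof (cases "i = j0")
  case True
  then show ?thesis by (intro ratfun.cong[OF ratfun.const[of 1]]) (use j0 in auto)
qed (use assms in \<open>auto intro: ratfun.generator\<close>)

text \<open>Criticality at x supplies the slope of piece i0, where the multiplier is 1.\<close>

lemma ratfun_slope_x:
  assumes "multipliers_x \<subseteq> Z" "\<And>i. i \<noteq> i0 \<Longrightarrow> (\<lambda>u. pd j (x u) (u $ i)) \<in> ratfun S Z"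
  shows "(\<lambda>u. pd j (x u) (u $ i)) \<in> ratfun S Z"
proof (cases "i = i0")
  case True
  show ?thesis unfolding True
    by (rule ratfun_solve[OF i0(1), of S l "\<lambda>i u. pd j (x u) (u $ i)"])
      (use crit_x i0 assms(2) ratfun_multiplier_x[OF assms(1)] in \<open>auto simp: crit_data_def\<close>)
qed (rule assms)

lemma ratfun_slope_y:
  assumes "multipliers_y \<subseteq> Z" "\<And>i. i \<noteq> j0 \<Longrightarrow> (\<lambda>u. pd j (y u) (u $ i)) \<in> ratfun S Z"
  shows "(\<lambda>u. pd j (y u) (u $ i)) \<in> ratfun S Z"
proof (cases "i = j0")
  case True
  show ?thesis unfolding True
    by (rule ratfun_solve[OF j0(1), of S m "\<lambda>i u. pd j (y u) (u $ i)"])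
      (use crit_y j0 assms(2) ratfun_multiplier_y[OF assms(1)] in \<open>auto simp: crit_data_def\<close>)
qed (rule assms)

context
  assumes x: "\<And>j. (\<lambda>u. x u $ j) \<in> ratfun S Z" and y: "\<And>j. (\<lambda>u. y u $ j) \<in> ratfun S Z"
begin

lemma separated_diff: "\<forall>u\<in>S. x u $ e - y u $ e \<noteq> 0"
  using separated by simp

lemma coef_ratfun_cubic:
  assumes "\<And>i. (\<lambda>u. poly_of_coeffs (x u) (u $ i)) \<in> ratfun S Z"
    "\<And>i. (\<lambda>u. poly_of_coeffs (y u) (u $ i)) \<in> ratfun S Z"
    "\<And>i j. (\<lambda>u. pd j (x u) (u $ i)) \<in> ratfun S Z" "\<And>i j. (\<lambda>u. pd j (y u) (u $ i)) \<in> ratfun S Z"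
  shows "(\<lambda>u. coef (u $ i) a) \<in> ratfun S Z"
  by (rule hermite_cubic[where x=x and y=y and e=e])
    (use assms x y separated_diff ratfun_free in \<open>auto intro: hermite_transversal[where x=x and y=y and e=e]\<close>)

lemma coef_ratfun_quadratic:
  assumes "CARD('d) = 2"
    "\<And>i. (\<lambda>u. poly_of_coeffs (x u) (u $ i)) \<in> ratfun S Z"
    "\<And>i. (\<lambda>u. poly_of_coeffs (y u) (u $ i)) \<in> ratfun S Z"
    "\<And>i j. (\<lambda>u. pd j (x u) (u $ i)) \<in> ratfun S Z" "\<And>i j. j \<noteq> e \<Longrightarrow> (\<lambda>u. pd j (y u) (u $ i)) \<in> ratfun S Z"
  shows "(\<lambda>u. coef (u $ i) a) \<in> ratfun S Z"
proof (rule hermite_quadratic[where x=x and y=y and e=e])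
  show "(\<lambda>u. coef (u $ i) (inc e (inc e (inc e (\<lambda>_. 0))))) \<in> ratfun S Z"
    using assms(1) by (simp add: coef_def ratfun.const)
qed (use assms x y separated_diff ratfun_free in \<open>auto intro: hermite_transversal[where x=x and y=y and e=e]\<close>)

lemma coef_ratfun_linear:
  assumes "CARD('d) = 1"
    "\<And>i. (\<lambda>u. poly_of_coeffs (x u) (u $ i)) \<in> ratfun S Z"
    "\<And>i. (\<lambda>u. poly_of_coeffs (y u) (u $ i)) \<in> ratfun S Z"
    "\<And>i j. j \<noteq> e \<Longrightarrow> (\<lambda>u. pd j (x u) (u $ i)) \<in> ratfun S Z"
  shows "(\<lambda>u. coef (u $ i) a) \<in> ratfun S Z"
proof (rule hermite_linear[where x=x and y=y and e=e])
  show "(\<lambda>u. coef (u $ i) (inc j (\<lambda>_. 0))) \<in> ratfun S Z" if "j \<noteq> e" for j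
    using assms(4)[OF that, of i] by (simp add: pd_linear[OF assms(1)])
qed (use assms x y separated_diff ratfun_free in \<open>auto simp: coef_def ratfun.const\<close>)

end

end

text \<open>Criticality replaces card I + card J values by t and eliminates 2n slopes. The price is
  2n + 1 generators for x, y, t and card I + card J - 2 multipliers, so one generator is saved in
  total.\<close>

lemma thin_cubic:
  assumes d: "CARD('d) \<ge> 3"
  shows "thin S"
proof (rule thin_coefficients)
  let ?Z = "coordinates UNIV \<union> multipliers_x \<union> multipliers_y \<union> values_x (- I) \<union> values_y (- J)
    \<union> slopes_x ((- {i0}) \<times> UNIV) \<union> slopes_y ((- {j0}) \<times> UNIV) \<union> free_coefficients"
  show "finite ?Z" by simp
  have "card ?Z \<le> card (coordinates UNIV) + card multipliers_x + card multipliers_y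
      + card (values_x (- I)) + card (values_y (- J)) + card (slopes_x ((- {i0}) \<times> UNIV))
      + card (slopes_y ((- {j0}) \<times> UNIV)) + card free_coefficients"
    by (intro card_Un_le[THEN order_trans] add_mono order_refl)
  also have "\<dots> \<le> (2 * CARD('n) + 1) + (card I - 1) + (card J - 1) + (CARD('r) - card I) + (CARD('r) - card J)
      + (CARD('r) - 1) * CARD('n) + (CARD('r) - 1) * CARD('n)
      + CARD('r) * card (free_indices e :: ('n, 'd) multi_index set)"
    using card_image_times_le[of _ "- {i0}" UNIV] card_image_times_le[of _ "- {j0}" UNIV]
    by (intro add_mono card_coordinates card_multipliers card_image_complement_le card_free_coefficients)
      (simp_all add: card_complement)
  also have "\<dots> < CARD('r) * (card (free_indices e :: ('n, 'd) multi_index set) + 2 + 2 * CARD('n))"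
  proof -
    obtain r where "CARD('r) = Suc r" by (metis card_gt_0_iff finite UNIV_not_empty gr0_conv_Suc)
    then show ?thesis using card_I_J by (simp add: algebra_simps)
  qed
  also have "\<dots> \<le> CARD('r) * CARD(('n, 'd) multi_index)"
    using card_free_indices[of e, where ?'d='d] d by (intro mult_le_mono2) simp
  finally show "card ?Z < CARD('r) * CARD(('n, 'd) multi_index)" .
  have x: "(\<lambda>u. x u $ j) \<in> ratfun S ?Z" and y: "(\<lambda>u. y u $ j) \<in> ratfun S ?Z" for j
    by (auto intro!: ratfun.generator)
  have vx: "(\<lambda>u. poly_of_coeffs (x u) (u $ i)) \<in> ratfun S ?Z" for i
    by (rule ratfun_value_x) (auto intro!: ratfun.generator)
  have vy: "(\<lambda>u. poly_of_coeffs (y u) (u $ i)) \<in> ratfun S ?Z" for i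
    by (rule ratfun_value_y) (auto intro!: ratfun.generator)
  have px: "(\<lambda>u. pd j (x u) (u $ i)) \<in> ratfun S ?Z" for i j
  proof (rule ratfun_slope_x)
    show "(\<lambda>u. pd j (x u) (u $ i)) \<in> ratfun S ?Z" if "i \<noteq> i0" for i
    proof -
      have "(\<lambda>u. pd j (x u) (u $ i)) \<in> slopes_x ((- {i0}) \<times> UNIV)"
        using that by (intro image_eqI[of _ _ "(i, j)"]) auto
      then show ?thesis by (intro ratfun.generator) blast
    qed
  qed auto
  have py: "(\<lambda>u. pd j (y u) (u $ i)) \<in> ratfun S ?Z" for i j
  proof (rule ratfun_slope_y)
    show "(\<lambda>u. pd j (y u) (u $ i)) \<in> ratfun S ?Z" if "i \<noteq> j0" for i
    proof -
      have "(\<lambda>u. pd j (y u) (u $ i)) \<in> slopes_y ((- {j0}) \<times> UNIV)"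
        using that by (intro image_eqI[of _ _ "(i, j)"]) auto
      then show ?thesis by (intro ratfun.generator) blast
    qed
  qed auto
  show "(\<lambda>u. coef (u $ i) a) \<in> ratfun S ?Z" for i a
    by (rule coef_ratfun_cubic[OF _ x y vx vy px py]) auto
qed

text \<open>The equalities of values alone are overdetermined: card I + card J \<ge> 2n + 2
  equations in the 2n + 1 unknowns x, y, t. An affine polynomial is described by its two values and
  its n - 1 slopes in the directions other than e.\<close>

lemma thin_many_linear_forms:
  assumes d: "CARD('d) = 1" and I: "CARD('n) < card I" and J: "CARD('n) < card J"
  shows "thin S"
proof (rule thin_coefficients)
  let ?Z = "coordinates UNIV \<union> values_x (- I) \<union> values_y (- J)
    \<union> slopes_x (UNIV \<times> (- {e})) \<union> free_coefficients"
  show "finite ?Z" by simp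
  have "card ?Z \<le> card (coordinates UNIV) + card (values_x (- I)) + card (values_y (- J))
      + card (slopes_x (UNIV \<times> (- {e}))) + card free_coefficients"
    by (intro card_Un_le[THEN order_trans] add_mono order_refl)
  also have "\<dots> \<le> (2 * CARD('n) + 1) + (CARD('r) - card I) + (CARD('r) - card J)
      + CARD('r) * (CARD('n) - 1) + CARD('r) * card (free_indices e :: ('n, 'd) multi_index set)"
    using card_image_times_le[of _ UNIV "- {e}"]
    by (intro add_mono card_coordinates card_image_complement_le card_free_coefficients)
      (simp_all add: card_complement)
  also have "\<dots> < CARD('r) * (card (free_indices e :: ('n, 'd) multi_index set) + 1 + CARD('n))"
  proof -
    obtain n where "CARD('n) = Suc n" by (metis card_gt_0_iff finite UNIV_not_empty gr0_conv_Suc)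
    then show ?thesis using card_I_J I J by (simp add: algebra_simps)
  qed
  also have "\<dots> \<le> CARD('r) * CARD(('n, 'd) multi_index)"
    using card_free_indices[of e, where ?'d='d] d by (intro mult_le_mono2) simp
  finally show "card ?Z < CARD('r) * CARD(('n, 'd) multi_index)" .
  have x: "(\<lambda>u. x u $ j) \<in> ratfun S ?Z" and y: "(\<lambda>u. y u $ j) \<in> ratfun S ?Z" for j
    by (auto intro!: ratfun.generator)
  have vx: "(\<lambda>u. poly_of_coeffs (x u) (u $ i)) \<in> ratfun S ?Z" for i
    by (rule ratfun_value_x) (auto intro!: ratfun.generator)
  have vy: "(\<lambda>u. poly_of_coeffs (y u) (u $ i)) \<in> ratfun S ?Z" for i
    by (rule ratfun_value_y) (auto intro!: ratfun.generator)
  have px: "(\<lambda>u. pd j (x u) (u $ i)) \<in> ratfun S ?Z" if "j \<noteq> e" for i j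
  proof -
    have "(\<lambda>u. pd j (x u) (u $ i)) \<in> slopes_x (UNIV \<times> (- {e}))"
      using that by (intro image_eqI[of _ _ "(i, j)"]) auto
    then show ?thesis by (intro ratfun.generator) blast
  qed
  show "(\<lambda>u. coef (u $ i) a) \<in> ratfun S ?Z" for i a
    by (rule coef_ratfun_linear[OF _ x y d vx vy px]) auto
qed

text \<open>For quadratic polynomials the directional slopes along \<open>x - y\<close> at the two points are tied to
  the difference of the values, so the criticality at \<open>y\<close> can be expressed by data at \<open>x\<close>.\<close>

lemma quadratic_relation:
  assumes d: "CARD('d) = 2" and u: "u \<in> S"
  shows "(\<Sum>i\<in>J. m u i * (2 * (poly_of_coeffs (x u) (u $ i) - t u)
    - (\<Sum>j\<in>UNIV. pd j (x u) (u $ i) * (x u $ j - y u $ j)))) = 0"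
proof -
  have "(\<Sum>i\<in>J. m u i * (2 * (poly_of_coeffs (x u) (u $ i) - t u)
    - (\<Sum>j\<in>UNIV. pd j (x u) (u $ i) * (x u $ j - y u $ j))))
    = (\<Sum>i\<in>J. \<Sum>j\<in>UNIV. m u i * (pd j (y u) (u $ i) * (x u $ j - y u $ j)))"
  proof (rule sum.cong[OF refl])
    fix i assume "i \<in> J"
    then have "poly_of_coeffs (y u) (u $ i) = t u"
      using crit_y[OF u] by (simp add: crit_data_def)
    then have "2 * (poly_of_coeffs (x u) (u $ i) - t u)
        = (\<Sum>j\<in>UNIV. pd j (x u) (u $ i) * (x u $ j - y u $ j)) + (\<Sum>j\<in>UNIV. pd j (y u) (u $ i) * (x u $ j - y u $ j))"
      using quadratic_value_difference[of "x u" "u $ i" "y u"] d by (simp add: distrib_right sum.distrib)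
    then show "m u i * (2 * (poly_of_coeffs (x u) (u $ i) - t u)
        - (\<Sum>j\<in>UNIV. pd j (x u) (u $ i) * (x u $ j - y u $ j)))
        = (\<Sum>j\<in>UNIV. m u i * (pd j (y u) (u $ i) * (x u $ j - y u $ j)))"
      by (simp add: sum_distrib_left)
  qed
  also have "\<dots> = (\<Sum>j\<in>UNIV. (\<Sum>i\<in>J. m u i * pd j (y u) (u $ i)) * (x u $ j - y u $ j))"
    by (subst sum.swap) (simp add: sum_distrib_right mult.assoc)
  also have "\<dots> = 0"
    using crit_y[OF u] by (simp add: crit_data_def)
  finally show ?thesis .
qed

text \<open>As j0 \<notin> I, the value of piece j0 at x is not tied to t. It occurs in
  \<open>quadratic_relation\<close> with a nonzero factor, and solving for it saves the
  generator.\<close>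

lemma thin_quadratic_unequal_supports:
  assumes d: "CARD('d) = 2" and j0I: "j0 \<notin> I"
  shows "thin S"
proof (rule thin_coefficients)
  \<comment> \<open>The e-slopes at y are left out because the other data determine them, the value
    of piece j0 at x because the relation yields it.\<close>
  let ?Z = "coordinates UNIV \<union> multipliers_x \<union> multipliers_y \<union> values_x (- insert j0 I) \<union> values_y (- J)
    \<union> slopes_x ((- {i0}) \<times> UNIV) \<union> slopes_y ((- {j0}) \<times> (- {e})) \<union> free_coefficients"
  show "finite ?Z" by simp
  have "card ?Z \<le> card (coordinates UNIV) + card multipliers_x + card multipliers_y
      + card (values_x (- insert j0 I)) + card (values_y (- J)) + card (slopes_x ((- {i0}) \<times> UNIV))
      + card (slopes_y ((- {j0}) \<times> (- {e}))) + card free_coefficients"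
    by (intro card_Un_le[THEN order_trans] add_mono order_refl)
  also have "\<dots> \<le> (2 * CARD('n) + 1) + (card I - 1) + (card J - 1) + (CARD('r) - card (insert j0 I)) + (CARD('r) - card J)
      + (CARD('r) - 1) * CARD('n) + (CARD('r) - 1) * (CARD('n) - 1)
      + CARD('r) * card (free_indices e :: ('n, 'd) multi_index set)"
    using card_image_times_le[of _ "- {i0}" UNIV] card_image_times_le[of _ "- {j0}" "- {e}"]
    by (intro add_mono card_coordinates card_multipliers card_image_complement_le card_free_coefficients)
      (simp_all add: card_complement)
  also have "\<dots> < CARD('r) * (card (free_indices e :: ('n, 'd) multi_index set) + 1 + 2 * CARD('n))"
  proof -
    obtain r where "CARD('r) = Suc r" by (metis card_gt_0_iff finite UNIV_not_empty gr0_conv_Suc)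
    moreover obtain n where "CARD('n) = Suc n" by (metis card_gt_0_iff finite UNIV_not_empty gr0_conv_Suc)
    moreover have "card (insert j0 I) \<le> CARD('r)" by (intro card_mono) auto
    ultimately show ?thesis using card_I_J j0I by (simp add: algebra_simps)
  qed
  also have "\<dots> \<le> CARD('r) * CARD(('n, 'd) multi_index)"
    using card_free_indices[of e, where ?'d='d] d by (intro mult_le_mono2) simp
  finally show "card ?Z < CARD('r) * CARD(('n, 'd) multi_index)" .
  have x: "(\<lambda>u. x u $ j) \<in> ratfun S ?Z" and y: "(\<lambda>u. y u $ j) \<in> ratfun S ?Z" for j
    by (auto intro!: ratfun.generator)
  have t: "t \<in> ratfun S ?Z"
    by (auto intro!: ratfun.generator)
  have vy: "(\<lambda>u. poly_of_coeffs (y u) (u $ i)) \<in> ratfun S ?Z" for i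
    by (rule ratfun_value_y) (auto intro!: ratfun.generator)
  have px: "(\<lambda>u. pd j (x u) (u $ i)) \<in> ratfun S ?Z" for i j
  proof (rule ratfun_slope_x)
    show "(\<lambda>u. pd j (x u) (u $ i)) \<in> ratfun S ?Z" if "i \<noteq> i0" for i
    proof -
      have "(\<lambda>u. pd j (x u) (u $ i)) \<in> slopes_x ((- {i0}) \<times> UNIV)"
        using that by (intro image_eqI[of _ _ "(i, j)"]) auto
      then show ?thesis by (intro ratfun.generator) blast
    qed
  qed auto
  have py: "(\<lambda>u. pd j (y u) (u $ i)) \<in> ratfun S ?Z" if "j \<noteq> e" for i j
  proof (rule ratfun_slope_y)
    show "(\<lambda>u. pd j (y u) (u $ i)) \<in> ratfun S ?Z" if "i \<noteq> j0" for i
    proof -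
      have "(\<lambda>u. pd j (y u) (u $ i)) \<in> slopes_y ((- {j0}) \<times> (- {e}))"
        using that \<open>j \<noteq> e\<close> by (intro image_eqI[of _ _ "(i, j)"]) auto
      then show ?thesis by (intro ratfun.generator) blast
    qed
  qed auto
  have vx_other: "(\<lambda>u. poly_of_coeffs (x u) (u $ i)) \<in> ratfun S ?Z" if "i \<noteq> j0" for i
    by (rule ratfun_value_x) (use that in \<open>auto intro!: ratfun.generator\<close>)
  define w where "w = (\<lambda>i u. \<Sum>j\<in>UNIV. pd j (x u) (u $ i) * (x u $ j - y u $ j))"
  have w: "w i \<in> ratfun S ?Z" for i
    unfolding w_def by (intro ratfun_intros px x y)
  have "(\<lambda>u. 2 * (poly_of_coeffs (x u) (u $ j0) - t u) - w j0 u) \<in> ratfun S ?Z"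
  proof (rule ratfun_solve[OF j0(1), of S m "\<lambda>i u. 2 * (poly_of_coeffs (x u) (u $ i) - t u) - w i u"])
    show "(\<Sum>i\<in>J. m u i * (2 * (poly_of_coeffs (x u) (u $ i) - t u) - w i u)) = 0" if "u \<in> S" for u
      using quadratic_relation[OF d that] by (simp add: w_def)
    show "(\<lambda>u. m u i) \<in> ratfun S ?Z" if "i \<in> J" for i
      using that by (intro ratfun_multiplier_y) auto
    show "(\<lambda>u. 2 * (poly_of_coeffs (x u) (u $ i) - t u) - w i u) \<in> ratfun S ?Z" if "i \<noteq> j0" for i
      by (intro ratfun_intros vx_other that t w)
  qed (use j0 in auto)
  from ratfun.add[OF ratfun.mult[OF ratfun.const[of "1/2"] ratfun.add[OF this w[of j0]]] t]
  have "(\<lambda>u. poly_of_coeffs (x u) (u $ j0)) \<in> ratfun S ?Z" by (simp add: field_simps)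
  with vx_other have vx: "(\<lambda>u. poly_of_coeffs (x u) (u $ i)) \<in> ratfun S ?Z" for i
    by (cases "i = j0") auto
  show "(\<lambda>u. coef (u $ i) a) \<in> ratfun S ?Z" for i a
    by (rule coef_ratfun_quadratic[OF _ x y d vx vy px py]) auto
qed

text \<open>On a common support the values at x cancel against t in
  \<open>quadratic_relation\<close>. Criticality at x gives a second equation for the slopes along x
  - y; the difference of the two has no i0 term and is solved for piece i1.\<close>

lemma thin_quadratic_unequal_multipliers:
  assumes d: "CARD('d) = 2" and IJ: "J = I" "j0 = i0"
    and i1: "i1 \<in> I" "\<And>u. u \<in> S \<Longrightarrow> l u i1 \<noteq> m u i1"
  shows "thin S"
proof (cases "S = {}")
  case False
  \<comment> \<open>Both multipliers are 1 at i0, so they cannot differ there.\<close>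
  then have "i1 \<noteq> i0" using i0 j0 i1 IJ by force
  show ?thesis
  proof (rule thin_coefficients)
    \<comment> \<open>Of the slopes of piece i1 at x only the e-slope is left out; it is recovered
      from the slope along x - y, in which it has the factor x_e - y_e.\<close>
    let ?Z = "coordinates UNIV \<union> multipliers_x \<union> multipliers_y \<union> values_x (- I) \<union> values_y (- I)
      \<union> slopes_x ((- {i0, i1}) \<times> UNIV) \<union> slopes_x ({i1} \<times> (- {e})) \<union> slopes_y ((- {i0}) \<times> (- {e}))
      \<union> free_coefficients"
    show "finite ?Z" by simp
    have "card ?Z \<le> card (coordinates UNIV) + card multipliers_x + card multipliers_y
        + card (values_x (- I)) + card (values_y (- I)) + card (slopes_x ((- {i0, i1}) \<times> UNIV))
        + card (slopes_x ({i1} \<times> (- {e}))) + card (slopes_y ((- {i0}) \<times> (- {e}))) + card free_coefficients"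
      by (intro card_Un_le[THEN order_trans] add_mono order_refl)
    also have "\<dots> \<le> (2 * CARD('n) + 1) + (card I - 1) + (card J - 1) + (CARD('r) - card I) + (CARD('r) - card I)
        + (CARD('r) - 2) * CARD('n) + 1 * (CARD('n) - 1) + (CARD('r) - 1) * (CARD('n) - 1)
        + CARD('r) * card (free_indices e :: ('n, 'd) multi_index set)"
      using card_image_times_le[of _ "- {i0, i1}" UNIV] card_image_times_le[of _ "- {i0}" "- {e}"]
        card_image_times_le[of _ "{i1}" "- {e}"] \<open>i1 \<noteq> i0\<close>
      by (intro add_mono card_coordinates card_multipliers card_image_complement_le card_free_coefficients)
        (simp_all add: card_complement numeral_2_eq_2)
    also have "\<dots> < CARD('r) * (card (free_indices e :: ('n, 'd) multi_index set) + 1 + 2 * CARD('n))"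
    proof -
      have "card {i0, i1} \<le> CARD('r)" by (intro card_mono) auto
      then have "2 \<le> CARD('r)" using \<open>i1 \<noteq> i0\<close> by simp
      then obtain r where "CARD('r) = 2 + r" using le_Suc_ex by blast
      moreover obtain n where "CARD('n) = Suc n" by (metis card_gt_0_iff finite UNIV_not_empty gr0_conv_Suc)
      ultimately show ?thesis using card_I_J IJ by (simp add: algebra_simps)
    qed
    also have "\<dots> \<le> CARD('r) * CARD(('n, 'd) multi_index)"
      using card_free_indices[of e, where ?'d='d] d by (intro mult_le_mono2) simp
    finally show "card ?Z < CARD('r) * CARD(('n, 'd) multi_index)" .
    have x: "(\<lambda>u. x u $ j) \<in> ratfun S ?Z" and y: "(\<lambda>u. y u $ j) \<in> ratfun S ?Z" for j
      by (auto intro!: ratfun.generator)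
    have vx: "(\<lambda>u. poly_of_coeffs (x u) (u $ i)) \<in> ratfun S ?Z" for i
      by (rule ratfun_value_x) (auto intro!: ratfun.generator)
    have vy: "(\<lambda>u. poly_of_coeffs (y u) (u $ i)) \<in> ratfun S ?Z" for i
      by (rule ratfun_value_y) (auto intro!: ratfun.generator simp: IJ)
    have px_other: "(\<lambda>u. pd j (x u) (u $ i)) \<in> ratfun S ?Z" if "i \<noteq> i0" "i \<noteq> i1 \<or> j \<noteq> e" for i j
    proof -
      have "(\<lambda>u. pd j (x u) (u $ i)) \<in> slopes_x ((- {i0, i1}) \<times> UNIV) \<union> slopes_x ({i1} \<times> (- {e}))"
        unfolding image_Un[symmetric] using that by (intro image_eqI[of _ _ "(i, j)"]) auto
      then show ?thesis by (intro ratfun.generator) blast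
    qed
    define w where "w = (\<lambda>i u. \<Sum>j\<in>UNIV. pd j (x u) (u $ i) * (x u $ j - y u $ j))"
    have "w i1 \<in> ratfun S ?Z"
    proof (rule ratfun_solve[of i1 "I - {i0}" S "\<lambda>u i. m u i - l u i" w])
      show "(\<Sum>i\<in>I - {i0}. (m u i - l u i) * w i u) = 0" if u: "u \<in> S" for u
      proof -
        have "(\<Sum>i\<in>I. l u i * w i u) = (\<Sum>i\<in>I. \<Sum>j\<in>UNIV. l u i * (pd j (x u) (u $ i) * (x u $ j - y u $ j)))"
          by (simp add: w_def sum_distrib_left)
        also have "\<dots> = (\<Sum>j\<in>UNIV. (\<Sum>i\<in>I. l u i * pd j (x u) (u $ i)) * (x u $ j - y u $ j))"
          by (subst sum.swap) (simp add: sum_distrib_right mult.assoc)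
        also have "\<dots> = 0" using crit_x[OF u] by (simp add: crit_data_def)
        finally have 1: "(\<Sum>i\<in>I. l u i * w i u) = 0" .
        have "(\<Sum>i\<in>I. m u i * w i u) = - (\<Sum>i\<in>J. m u i * (2 * (poly_of_coeffs (x u) (u $ i) - t u) - w i u))"
          unfolding IJ(1) sum_negf[symmetric]
          by (intro sum.cong) (use crit_x[OF u] in \<open>auto simp: crit_data_def\<close>)
        also have "\<dots> = 0" using quadratic_relation[OF d u] by (simp add: w_def)
        finally have "(\<Sum>i\<in>I. (m u i - l u i) * w i u) = 0"
          using 1 by (simp add: left_diff_distrib sum_subtractf)
        then show ?thesis
          using i0 j0(2) IJ(2) u by (simp add: sum.remove[of I i0])
      qed
      show "(\<lambda>u. m u i - l u i) \<in> ratfun S ?Z" if "i \<in> I - {i0}" for i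
        using that by (intro ratfun_diff ratfun_multiplier_x ratfun_multiplier_y) (auto simp: IJ)
      show "w i \<in> ratfun S ?Z" if "i \<in> I - {i0}" "i \<noteq> i1" for i
        unfolding w_def using that by (intro ratfun_intros px_other x y) auto
      show "i1 \<in> I - {i0}" using i1(1) \<open>i1 \<noteq> i0\<close> by simp
      show "m u i1 - l u i1 \<noteq> 0" if "u \<in> S" for u using i1(2)[OF that] by simp
    qed
    moreover have "(\<lambda>u. \<Sum>j\<in>UNIV - {e}. pd j (x u) (u $ i1) * (x u $ j - y u $ j)) \<in> ratfun S ?Z"
      using \<open>i1 \<noteq> i0\<close> by (intro ratfun_intros px_other x y) auto
    ultimately have "(\<lambda>u. w i1 u - (\<Sum>j\<in>UNIV - {e}. pd j (x u) (u $ i1) * (x u $ j - y u $ j))) \<in> ratfun S ?Z"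
      by (rule ratfun_diff)
    then have "(\<lambda>u. pd e (x u) (u $ i1) * (x u $ e - y u $ e)) \<in> ratfun S ?Z"
      unfolding w_def by (simp add: sum.remove[of UNIV e])
    then have "(\<lambda>u. pd e (x u) (u $ i1)) \<in> ratfun S ?Z"
      by (rule ratfun_cancel[OF _ ratfun_diff[OF x y]]) (use separated in simp)
    then have "(\<lambda>u. pd j (x u) (u $ i)) \<in> ratfun S ?Z" if "i \<noteq> i0" for i j
      using px_other[OF that, of j] by (cases "i = i1 \<and> j = e") auto
    then have px: "(\<lambda>u. pd j (x u) (u $ i)) \<in> ratfun S ?Z" for i j
      by (rule ratfun_slope_x[rotated 2]) auto
    have py: "(\<lambda>u. pd j (y u) (u $ i)) \<in> ratfun S ?Z" if "j \<noteq> e" for i j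
    proof (rule ratfun_slope_y)
      show "(\<lambda>u. pd j (y u) (u $ i)) \<in> ratfun S ?Z" if "i \<noteq> j0" for i
      proof -
        have "(\<lambda>u. pd j (y u) (u $ i)) \<in> slopes_y ((- {i0}) \<times> (- {e}))"
          using that IJ \<open>j \<noteq> e\<close> by (intro image_eqI[of _ _ "(i, j)"]) auto
        then show ?thesis by (intro ratfun.generator) blast
      qed
    qed auto
    show "(\<lambda>u. coef (u $ i) a) \<in> ratfun S ?Z" for i a
      by (rule coef_ratfun_quadratic[OF _ x y d vx vy px py]) auto
  qed
qed (simp add: thin_empty)

text \<open>The multipliers at y cost no generators. \<open>B\<close> lists the coordinates of the
  points that do; the others are constant. The bound on \<open>card B\<close> allows B = UNIV if
  card I \<ge> 2 and asks for a constant coordinate if card I = 1.\<close>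

lemma thin_quadratic_equal_multipliers:
  assumes d: "CARD('d) = 2" and IJ: "J = I" "j0 = i0" "m = l"
    and B: "2 * card B + 1 < 2 * CARD('n) + card I"
      "\<And>j u. j \<notin> B \<Longrightarrow> u \<in> S \<Longrightarrow> x u $ j = b j" "\<And>j u. j \<notin> B \<Longrightarrow> u \<in> S \<Longrightarrow> y u $ j = b' j"
  shows "thin S"
proof (rule thin_coefficients)
  let ?Z = "coordinates B \<union> multipliers_x \<union> values_x (- I) \<union> values_y (- I)
    \<union> slopes_x ((- {i0}) \<times> UNIV) \<union> slopes_y ((- {i0}) \<times> (- {e})) \<union> free_coefficients"
  show "finite ?Z" by simp
  have "card ?Z \<le> card (coordinates B) + card multipliers_x
      + card (values_x (- I)) + card (values_y (- I)) + card (slopes_x ((- {i0}) \<times> UNIV))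
      + card (slopes_y ((- {i0}) \<times> (- {e}))) + card free_coefficients"
    by (intro card_Un_le[THEN order_trans] add_mono order_refl)
  also have "\<dots> \<le> (2 * card B + 1) + (card I - 1) + (CARD('r) - card I) + (CARD('r) - card I)
      + (CARD('r) - 1) * CARD('n) + (CARD('r) - 1) * (CARD('n) - 1)
      + CARD('r) * card (free_indices e :: ('n, 'd) multi_index set)"
    using card_image_times_le[of _ "- {i0}" UNIV] card_image_times_le[of _ "- {i0}" "- {e}"]
    by (intro add_mono card_coordinates card_multipliers card_image_complement_le card_free_coefficients)
      (simp_all add: card_complement)
  also have "\<dots> < CARD('r) * (card (free_indices e :: ('n, 'd) multi_index set) + 1 + 2 * CARD('n))"
  proof -
    obtain r where "CARD('r) = Suc r" by (metis card_gt_0_iff finite UNIV_not_empty gr0_conv_Suc)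
    moreover obtain n where "CARD('n) = Suc n" by (metis card_gt_0_iff finite UNIV_not_empty gr0_conv_Suc)
    ultimately show ?thesis using card_I_J B(1) by (simp add: algebra_simps)
  qed
  also have "\<dots> \<le> CARD('r) * CARD(('n, 'd) multi_index)"
    using card_free_indices[of e, where ?'d='d] d by (intro mult_le_mono2) simp
  finally show "card ?Z < CARD('r) * CARD(('n, 'd) multi_index)" .
  have x: "(\<lambda>u. x u $ j) \<in> ratfun S ?Z" and y: "(\<lambda>u. y u $ j) \<in> ratfun S ?Z" for j
  proof -
    show "(\<lambda>u. x u $ j) \<in> ratfun S ?Z"
      by (cases "j \<in> B") (use B(2) in \<open>auto intro: ratfun.generator ratfun.cong[OF ratfun.const[of "b j"]]\<close>)
    show "(\<lambda>u. y u $ j) \<in> ratfun S ?Z"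
      by (cases "j \<in> B") (use B(3) in \<open>auto intro: ratfun.generator ratfun.cong[OF ratfun.const[of "b' j"]]\<close>)
  qed
  have vx: "(\<lambda>u. poly_of_coeffs (x u) (u $ i)) \<in> ratfun S ?Z" for i
    by (rule ratfun_value_x) (auto intro!: ratfun.generator)
  have vy: "(\<lambda>u. poly_of_coeffs (y u) (u $ i)) \<in> ratfun S ?Z" for i
    by (rule ratfun_value_y) (auto intro!: ratfun.generator simp: IJ)
  have px: "(\<lambda>u. pd j (x u) (u $ i)) \<in> ratfun S ?Z" for i j
  proof (rule ratfun_slope_x)
    show "(\<lambda>u. pd j (x u) (u $ i)) \<in> ratfun S ?Z" if "i \<noteq> i0" for i
    proof -
      have "(\<lambda>u. pd j (x u) (u $ i)) \<in> slopes_x ((- {i0}) \<times> UNIV)"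
        using that by (intro image_eqI[of _ _ "(i, j)"]) auto
      then show ?thesis by (intro ratfun.generator) blast
    qed
  qed auto
  have py: "(\<lambda>u. pd j (y u) (u $ i)) \<in> ratfun S ?Z" if "j \<noteq> e" for i j
  proof (rule ratfun_slope_y)
    show "(\<lambda>u. pd j (y u) (u $ i)) \<in> ratfun S ?Z" if "i \<noteq> j0" for i
    proof -
      have "(\<lambda>u. pd j (y u) (u $ i)) \<in> slopes_y ((- {i0}) \<times> (- {e}))"
        using that IJ \<open>j \<noteq> e\<close> by (intro image_eqI[of _ _ "(i, j)"]) auto
      then show ?thesis by (intro ratfun.generator) blast
    qed
  qed (auto simp: IJ)
  show "(\<lambda>u. coef (u $ i) a) \<in> ratfun S ?Z" for i a
    by (rule coef_ratfun_quadratic[OF _ x y d vx vy px py]) auto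
qed

end

section \<open>Covering the bad coefficients by finitely many families\<close>

lemma crit_data_cong:
  "(\<And>i. i \<in> I \<Longrightarrow> l i = l' i) \<Longrightarrow> crit_data u x t I l \<longleftrightarrow> crit_data u x t I l'"
  unfolding crit_data_def by (auto cong: sum.cong)

text \<open>\<open>Q\<close> carries the extra conditions on the witnesses that separate the
  quadratic cases.\<close>

definition pair_set :: "(real ^ 'n::finite \<Rightarrow> real ^ 'n \<Rightarrow> ('r::finite \<Rightarrow> real) \<Rightarrow> ('r \<Rightarrow> real) \<Rightarrow> bool) \<Rightarrow>
    'r set \<Rightarrow> 'r set \<Rightarrow> 'n \<Rightarrow> 'r \<Rightarrow> 'r \<Rightarrow> (real ^ ('n, 'd::finite) multi_index ^ 'r) set" where
  "pair_set Q I J e i0 j0 = {u. \<exists>x y t l m. x $ e \<noteq> y $ e \<and>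
    crit_data u x t I l \<and> crit_data u y t J m \<and> l i0 = 1 \<and> m j0 = 1 \<and> Q x y l m}"

text \<open>Choosing witnesses for each u separately yields the functions that the locale asks
  for.\<close>

lemma thin_pair_set:
  assumes "i0 \<in> I" "j0 \<in> J"
    and thin: "\<And>(S :: (real ^ ('n::finite, 'd::finite) multi_index ^ 'r::finite) set) x y t l m.
      critical_pairs S x y t l m I J e i0 j0 \<Longrightarrow> \<forall>u\<in>S. Q (x u) (y u) (l u) (m u) \<Longrightarrow> thin S"
  shows "thin (pair_set Q I J e i0 j0 :: (real ^ ('n, 'd) multi_index ^ 'r) set)"
    (is "thin ?S")
proof -
  have "\<forall>u\<in>?S. \<exists>p. case p of (x, y, t, l, m) \<Rightarrow> x $ e \<noteq> y $ e \<and>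
    crit_data u x t I l \<and> crit_data u y t J m \<and> l i0 = 1 \<and> m j0 = 1 \<and> Q x y l m"
    by (auto simp: pair_set_def)
  from bchoice[OF this] obtain p where "\<forall>u\<in>?S. case p u of (x, y, t, l, m) \<Rightarrow> x $ e \<noteq> y $ e \<and>
    crit_data u x t I l \<and> crit_data u y t J m \<and> l i0 = 1 \<and> m j0 = 1 \<and> Q x y l m"
    by blast
  then show ?thesis
    using assms(1,2)
    by (intro thin[of _ "\<lambda>u. fst (p u)" "\<lambda>u. fst (snd (p u))" "\<lambda>u. fst (snd (snd (p u)))"
        "\<lambda>u. fst (snd (snd (snd (p u))))" "\<lambda>u. snd (snd (snd (snd (p u))))"] critical_pairs.intro)
      (auto simp: case_prod_beta)
qed

lemma crit_data_normalized:
  assumes "crit_data u x t I l" "i0 \<in> I"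
  obtains l' where "crit_data u x t I l'" "l' i0 = 1"
proof -
  have "l i0 / l i0 = 1" using assms by (simp add: crit_data_def)
  with crit_data_normalize[OF assms] that show ?thesis by blast
qed

text \<open>The gradient of a quadratic polynomial is affine, so it vanishes on the whole line
  through two of its zeros, and the polynomial is constant there.\<close>

lemma crit_data_quadratic_line:
  fixes u :: "real ^ ('n::finite, 'd::finite) multi_index ^ 'r::finite"
  assumes d: "CARD('d) = 2" and l: "l i = 1"
    and crit: "crit_data u x t {i} l" "crit_data u y t {i} l"
  shows "crit_data u (x + q *\<^sub>R (y - x)) t {i} l"
proof -
  define z where "z = x + q *\<^sub>R (y - x)"
  have p: "pd j x (u $ i) = 0" "pd j y (u $ i) = 0" for j
    using crit l by (simp_all add: crit_data_def)
  then have pz: "pd j z (u $ i) = 0" for j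
    using d by (simp add: z_def quadratic_gradient_affine)
  have "2 * (poly_of_coeffs z (u $ i) - poly_of_coeffs x (u $ i)) = 0"
    using d by (subst quadratic_value_difference) (simp_all add: p pz)
  then show ?thesis
    using crit l pz by (simp add: crit_data_def z_def)
qed

definition coincident :: "(real ^ ('n::finite, 'd::finite) multi_index ^ 'r::finite) set" where
  "coincident = {u. \<exists>x y t I l J m. x \<noteq> y \<and> crit_data u x t I l \<and> crit_data u y t J m}"

lemma coincidentE:
  assumes "u \<in> coincident"
  obtains x y t I l J m e where "x $ e \<noteq> y $ e" "crit_data u x t I l" "crit_data u y t J m"
  using assms by (auto simp: coincident_def vec_eq_iff)

lemma thin_coincident_cubic:
  assumes "CARD('d) \<ge> 3"
  shows "thin (coincident :: (real ^ ('n::finite, 'd::finite) multi_index ^ 'r::finite) set)"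
proof -
  define T where "T = (\<lambda>(I, J, e, i0, j0).
    pair_set (\<lambda>_ _ _ _. True) I J e i0 j0 :: (real ^ ('n, 'd) multi_index ^ 'r) set)"
  define A where "A = {(I :: 'r set, J :: 'r set, e :: 'n, i0, j0). i0 \<in> I \<and> j0 \<in> J}"
  have "thin (\<Union>p\<in>A. T p)"
    by (rule thin_UN)
      (auto simp: A_def T_def intro!: thin_pair_set intro: critical_pairs.thin_cubic[OF _ assms])
  moreover have "coincident \<subseteq> (\<Union>p\<in>A. T p)"
  proof
    fix u :: "real ^ ('n, 'd) multi_index ^ 'r" assume "u \<in> coincident"
    then obtain x y t I l J m e where *: "x $ e \<noteq> y $ e" "crit_data u x t I l" "crit_data u y t J m"
      by (rule coincidentE)
    then obtain i0 j0 where ij: "i0 \<in> I" "j0 \<in> J" by (auto simp: crit_data_def)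
    obtain l' where "crit_data u x t I l'" "l' i0 = 1" by (rule crit_data_normalized[OF *(2) ij(1)])
    moreover obtain m' where "crit_data u y t J m'" "m' j0 = 1" by (rule crit_data_normalized[OF *(3) ij(2)])
    ultimately have "u \<in> T (I, J, e, i0, j0)" using *(1) unfolding T_def pair_set_def by blast
    moreover have "(I, J, e, i0, j0) \<in> A" using ij by (simp add: A_def)
    ultimately show "u \<in> (\<Union>p\<in>A. T p)" by blast
  qed
  ultimately show ?thesis by (rule thin_subset)
qed

text \<open>A support of at most n pieces is exceptional already at its own point; two larger
  supports overdetermine the common value.\<close>

lemma thin_coincident_linear:
  assumes d: "CARD('d) = 1"
  shows "thin (coincident :: (real ^ ('n::finite, 'd::finite) multi_index ^ 'r::finite) set)"
proof -
  define T where "T = (\<lambda>(I, J, e, i0, j0).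
    pair_set (\<lambda>_ _ _ _. True) I J e i0 j0 :: (real ^ ('n, 'd) multi_index ^ 'r) set)"
  define A where "A = {(I :: 'r set, J :: 'r set, e :: 'n, i0, j0). i0 \<in> I \<and> j0 \<in> J \<and>
    CARD('n) < card I \<and> CARD('n) < card J}"
  define T' where "T' = (\<lambda>(I, i0). {u :: real ^ ('n, 'd) multi_index ^ 'r. \<exists>x t l.
    crit_data u x t I l \<and> l i0 = 1})"
  define A' where "A' = {(I :: 'r set, i0). i0 \<in> I \<and> card I \<le> CARD('n)}"
  have "thin (\<Union>p\<in>A. T p)"
    by (rule thin_UN)
      (auto simp: A_def T_def intro!: thin_pair_set
        intro: critical_pairs.thin_many_linear_forms[OF _ d])
  moreover have "thin (\<Union>p\<in>A'. T' p)"
  proof (rule thin_UN)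
    fix p assume p: "p \<in> A'"
    then obtain I i0 where I: "p = (I, i0)" "i0 \<in> I" "card I \<le> CARD('n)"
      by (auto simp: A'_def)
    have "\<forall>u\<in>T' p. \<exists>p. case p of (x, t, l) \<Rightarrow> crit_data u x t I l \<and> l i0 = 1"
      using I by (auto simp: T'_def)
    from bchoice[OF this] obtain q
      where "\<forall>u\<in>T' p. case q u of (x, t, l) \<Rightarrow> crit_data u x t I l \<and> l i0 = 1"
      by blast
    then show "thin (T' p)"
      by (intro thin_few_linear_forms[OF d I(3,2), of _ "\<lambda>u. fst (q u)" "\<lambda>u. fst (snd (q u))" "\<lambda>u. snd (snd (q u))"])
        (auto simp: case_prod_beta)
  qed simp
  ultimately have "thin ((\<Union>p\<in>A. T p) \<union> (\<Union>p\<in>A'. T' p))"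
    by (rule thin_Un)
  moreover have "coincident \<subseteq> (\<Union>p\<in>A. T p) \<union> (\<Union>p\<in>A'. T' p)"
  proof
    fix u :: "real ^ ('n, 'd) multi_index ^ 'r" assume "u \<in> coincident"
    then obtain x y t I l J m e where *: "x $ e \<noteq> y $ e" "crit_data u x t I l" "crit_data u y t J m"
      by (rule coincidentE)
    then obtain i0 j0 where ij: "i0 \<in> I" "j0 \<in> J" by (auto simp: crit_data_def)
    obtain l' where l': "crit_data u x t I l'" "l' i0 = 1" by (rule crit_data_normalized[OF *(2) ij(1)])
    obtain m' where m': "crit_data u y t J m'" "m' j0 = 1" by (rule crit_data_normalized[OF *(3) ij(2)])
    consider "card I \<le> CARD('n)" | "card J \<le> CARD('n)" | "CARD('n) < card I" "CARD('n) < card J"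
      by linarith
    then show "u \<in> (\<Union>p\<in>A. T p) \<union> (\<Union>p\<in>A'. T' p)"
    proof cases
      case 1
      then have "(I, i0) \<in> A'" using ij by (simp add: A'_def)
      moreover have "u \<in> T' (I, i0)" using l' by (auto simp: T'_def)
      ultimately show ?thesis by blast
    next
      case 2
      then have "(J, j0) \<in> A'" using ij by (simp add: A'_def)
      moreover have "u \<in> T' (J, j0)" using m' by (auto simp: T'_def)
      ultimately show ?thesis by blast
    next
      case 3
      then have "(I, J, e, i0, j0) \<in> A" using ij by (simp add: A_def)
      moreover have "u \<in> T (I, J, e, i0, j0)" using *(1) l' m' unfolding T_def pair_set_def by blast
      ultimately show ?thesis by blast
    qed
  qed
  ultimately show ?thesis by (rule thin_subset)
qed

lemma thin_coincident_quadratic: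
  assumes d: "CARD('d) = 2"
  shows "thin (coincident :: (real ^ ('n::finite, 'd::finite) multi_index ^ 'r::finite) set)"
proof -
  define Ta where "Ta = (\<Union>(I, J, e, i0, j0)\<in>{(I, J, e, i0, j0). i0 \<in> I \<and> j0 \<in> J \<and> j0 \<notin> I}.
    (pair_set (\<lambda>x y l m. True) I J e i0 j0 :: (real ^ ('n, 'd) multi_index ^ 'r) set))"
  define Tb where "Tb = (\<Union>(I, e, i0, i1)\<in>{(I, e, i0, i1). i0 \<in> I \<and> i1 \<in> I}.
    (pair_set (\<lambda>x y l m. l i1 \<noteq> m i1) I I e i0 i0 :: (real ^ ('n, 'd) multi_index ^ 'r) set))"
  define Tc where "Tc = (\<Union>(I, e, i0)\<in>{(I, e, i0). i0 \<in> I \<and> 2 \<le> card I}.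
    (pair_set (\<lambda>x y l m. m = l) I I e i0 i0 :: (real ^ ('n, 'd) multi_index ^ 'r) set))"
  \<comment> \<open>A single quadratic polynomial is critical along the whole line through the two points, so these
    can be moved to the hyperplanes \<open>x $ e = 0\<close> and \<open>y $ e = 1\<close>; this saves two parameters.\<close>
  define Td where "Td = (\<Union>(e, i0)\<in>UNIV.
    (pair_set (\<lambda>x y l m. m = l \<and> x $ e = 0 \<and> y $ e = 1) {i0} {i0} e i0 i0 :: (real ^ ('n, 'd) multi_index ^ 'r) set))"
  have "thin Ta"
    unfolding Ta_def
    by (rule thin_UN) (auto intro!: thin_pair_set
        intro: critical_pairs.thin_quadratic_unequal_supports[OF _ d])
  moreover have "thin Tb"
    unfolding Tb_def
    by (rule thin_UN) (auto intro!: thin_pair_set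
        intro: critical_pairs.thin_quadratic_unequal_multipliers[OF _ d])
  moreover have equal: "critical_pairs S x y t l l I J e i0 i0"
    if "critical_pairs S x y t l m I J e i0 i0" "\<forall>u\<in>S. m u = l u"
    for S :: "(real ^ ('n, 'd) multi_index ^ 'r) set" and x y t l m I J e i0
    using that by (simp add: critical_pairs_def)
  have "thin Tc"
    unfolding Tc_def
  proof (rule thin_UN, simp, clarify)
    fix I :: "'r set" and e :: 'n and i0 assume I: "i0 \<in> I" "2 \<le> card I"
    show "thin (pair_set (\<lambda>x y l m. m = l) I I e i0 i0 :: (real ^ ('n, 'd) multi_index ^ 'r) set)"
    proof (rule thin_pair_set[OF I(1) I(1)])
      fix S :: "(real ^ ('n, 'd) multi_index ^ 'r) set" and x y t l m
      assume "critical_pairs S x y t l m I I e i0 i0" "\<forall>u\<in>S. m u = l u"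
      from critical_pairs.thin_quadratic_equal_multipliers[OF equal[OF this] d refl refl refl, of UNIV]
      show "thin S" using I(2) by simp
    qed
  qed
  moreover have "thin Td"
    unfolding Td_def
  proof (rule thin_UN, simp, clarify)
    fix e :: 'n and i0 :: 'r
    show "thin (pair_set (\<lambda>x y l m. m = l \<and> x $ e = 0 \<and> y $ e = 1) {i0} {i0} e i0 i0
      :: (real ^ ('n, 'd) multi_index ^ 'r) set)"
    proof (rule thin_pair_set)
      fix S :: "(real ^ ('n, 'd) multi_index ^ 'r) set" and x y t l m
      assume *: "critical_pairs S x y t l m {i0} {i0} e i0 i0"
        "\<forall>u\<in>S. m u = l u \<and> x u $ e = 0 \<and> y u $ e = 1"
      \<comment> \<open>With coordinate e constant at both points the bound reads 2n - 1 < 2n +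
        1.\<close>
      have "2 * card (- {e}) + 1 < 2 * CARD('n) + card {i0}"
        using card_complement[of "{e}"] by (simp add: card_gt_0_iff)
      with critical_pairs.thin_quadratic_equal_multipliers[OF equal[OF *(1)] d refl refl refl,
          of "- {e}" "\<lambda>_. 0" "\<lambda>_. 1"]
      show "thin S" using *(2) by simp
    qed simp_all
  qed
  ultimately have "thin (Ta \<union> Tb \<union> Tc \<union> Td)"
    by (intro thin_Un)
  moreover have "coincident \<subseteq> Ta \<union> Tb \<union> Tc \<union> Td"
  proof
    fix u :: "real ^ ('n, 'd) multi_index ^ 'r" assume "u \<in> coincident"
    then obtain x y t I l J m e where *: "x $ e \<noteq> y $ e" "crit_data u x t I l" "crit_data u y t J m"
      by (rule coincidentE)
    then have ne: "I \<noteq> {}" "J \<noteq> {}" by (auto simp: crit_data_def)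
    \<comment> \<open>Stated for arbitrary points and supports, so that it also applies with the two
      points exchanged, to an index in I but not in J.\<close>
    have Ta: "u \<in> Ta"
      if xy: "x $ e \<noteq> y $ e" and crit: "crit_data u x t I l" "crit_data u y t J m"
        and ij: "i0 \<in> I" "j0 \<in> J" "j0 \<notin> I"
      for x y :: "real ^ 'n" and I l J m i0 j0
    proof -
      obtain l' where "crit_data u x t I l'" "l' i0 = 1" by (rule crit_data_normalized[OF crit(1) ij(1)])
      moreover obtain m' where "crit_data u y t J m'" "m' j0 = 1" by (rule crit_data_normalized[OF crit(2) ij(2)])
      ultimately have "u \<in> pair_set (\<lambda>x y l m. True) I J e i0 j0"
        using xy unfolding pair_set_def by blast
      with ij show ?thesis unfolding Ta_def by blast
    qed
    show "u \<in> Ta \<union> Tb \<union> Tc \<union> Td"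
    proof (cases "I = J")
      case False
      then consider i0 j0 where "i0 \<in> I" "j0 \<in> J" "j0 \<notin> I" | i0 j0 where "i0 \<in> I" "j0 \<in> J" "i0 \<notin> J"
        using ne by blast
      then show ?thesis
        using Ta[OF *] Ta[OF *(1)[symmetric] *(3,2)] by cases auto
    next
      case True
      obtain i0 where i0: "i0 \<in> I" using ne by blast
      obtain l' where l': "crit_data u x t I l'" "l' i0 = 1" by (rule crit_data_normalized[OF *(2) i0])
      obtain m' where m': "crit_data u y t I m'" "m' i0 = 1"
        using crit_data_normalized[OF *(3)] i0 True by metis
      show ?thesis
      proof (cases "\<forall>i\<in>I. l' i = m' i")
        case False
        then obtain i1 where i1: "i1 \<in> I" "l' i1 \<noteq> m' i1" by blast
        then have "u \<in> pair_set (\<lambda>x y l m. l i1 \<noteq> m i1) I I e i0 i0"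
          using *(1) l' m' unfolding pair_set_def by blast
        with i0 i1 show ?thesis unfolding Tb_def by blast
      next
        case eq: True
        \<comment> \<open>Multipliers matter on I only, so \<open>m'\<close> can be replaced by
          \<open>l'\<close> itself, as \<open>Tc\<close> and \<open>Td\<close> require.\<close>
        then have y: "crit_data u y t I l'" using m' crit_data_cong by metis
        show ?thesis
        proof (cases "2 \<le> card I")
          case True
          have "u \<in> pair_set (\<lambda>x y l m. m = l) I I e i0 i0"
            using *(1) l' y unfolding pair_set_def by blast
          with i0 True show ?thesis unfolding Tc_def by blast
        next
          case False
          then have "card I \<le> card {i0}" by simp
          then have I: "I = {i0}" using i0 card_seteq[of I "{i0}"] by simp
          \<comment> \<open>The parameter is chosen so that \<open>z a\<close> is the point of the
            line through x and y whose coordinate e equals a.\<close>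
          define z where "z = (\<lambda>a. x + ((a - x $ e) / (y $ e - x $ e)) *\<^sub>R (y - x))"
          have "crit_data u (z a) t {i0} l'" for a
            unfolding z_def by (rule crit_data_quadratic_line) (use d l' y I in auto)
          moreover have "z a $ e = a" for a
            using *(1) by (simp add: z_def)
          ultimately have "u \<in> pair_set (\<lambda>x y l m. m = l \<and> x $ e = 0 \<and> y $ e = 1) {i0} {i0} e i0 i0"
            unfolding pair_set_def using l'(2)
            by (intro CollectI exI[of _ "z 0"] exI[of _ "z 1"] exI[of _ t] exI[of _ l']) simp
          then show ?thesis unfolding Td_def by blast
        qed
      qed
    qed
  qed
  ultimately show ?thesis by (rule thin_subset)
qed

lemma thin_coincident:
  "thin (coincident :: (real ^ ('n::finite, 'd::finite) multi_index ^ 'r::finite) set)"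
proof -
  have "CARD('d) \<noteq> 0" by simp
  then consider "CARD('d) = 1" | "CARD('d) = 2" | "CARD('d) \<ge> 3" by linarith
  then show ?thesis
    by cases (auto intro: thin_coincident_linear thin_coincident_quadratic thin_coincident_cubic)
qed

theorem theorem4p2:
  "\<exists>U4 :: (real ^ ('n::finite, 'd::finite) multi_index ^ 'r::finite) set.
     open U4 \<and> closure U4 = UNIV \<and> semialgebraic U4 \<and>
     (\<forall>u\<in>U4.
       \<forall>x0\<in>Crit (continuous_selections (\<lambda>x. poly_map x u)).
       \<forall>x0'\<in>Crit (continuous_selections (\<lambda>x. poly_map x u)).
         x0 \<noteq> x0' \<longrightarrow>
         (\<forall>f\<in>continuous_selections (\<lambda>x. poly_map x u).
          \<forall>f'\<in>continuous_selections (\<lambda>x. poly_map x u).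
            critical_point f x0 \<longrightarrow> critical_point f' x0' \<longrightarrow> f x0 \<noteq> f' x0'))"
proof -
  obtain U4 :: "(real ^ ('n, 'd) multi_index ^ 'r) set"
    where U4: "open U4" "closure U4 = UNIV" "semialgebraic U4" "U4 \<inter> coincident = {}"
    using thin_imp_open_dense_semialgebraic[OF thin_coincident] .
  have "f x0 \<noteq> f' x0'"
    if u: "u \<in> U4" and ne: "x0 \<noteq> x0'" and fs:
      "f \<in> continuous_selections (\<lambda>x. poly_map x u)" "f' \<in> continuous_selections (\<lambda>x. poly_map x u)"
      "critical_point f x0" "critical_point f' x0'"
    for u x0 x0' f f'
  proof
    assume "f x0 = f' x0'"
    then obtain I l J m where "crit_data u x0 (f x0) I l" "crit_data u x0' (f x0) J m"
      using critical_selection_crit_data[OF fs(1,3)] critical_selection_crit_data[OF fs(2,4)] by auto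
    then have "u \<in> coincident"
      using ne unfolding coincident_def by blast
    with u U4(4) show False by blast
  qed
  with U4(1-3) show ?thesis by blast
qed

end
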